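(* Let $r>1/2$. Consider the quadratic Schrödinger equation $i\partial_tu=-\partial_x^2u+\mu|u|^2$ on $(0,T)\times\mathbb T$, let $\mathcal F_\tau$ be the exact fine propagator, and let $\mathcal G_\tau(v)=e^{i\tau\partial_x^2}v+\Phi_{c,1}(\tau;v)$ be the coarse propagator with $$\Phi_{c,1}(\tau;v)=-i\mu\tau\,\overline{\hat v_0}\,e^{i\tau\partial_x^2}v-\frac{i\mu\tau}{2\pi}\|v\|_{L^2}^2+i\mu\tau|\hat v_0|^2+\frac{\mu}{2}\partial_x^{-1}\Big[\big(e^{i\tau\partial_x^2}v\big)\big(e^{-i\tau\partial_x^2}\partial_x^{-1}\bar v\big)-e^{i\tau\partial_x^2}\big(v\,\partial_x^{-1}\bar v\big)\Big].$$ Then, for $R>0$ and $B_R=\{v\in H^r(\mathbb T):\|v\|_{H^r}\le R\}$, the following inequalities hold for all $w_0,v_0\in B_R$ and $0<\tau\le1$, with a constant $C_R$ independent of $w_0$, $v_0$ and $\tau$: (i) $\|\Phi_{c,1}(\tau;w_0)-\Phi_{c,1}(\tau;v_0)\|_{H^r}\le C_R\,\tau\,\|w_0-v_0\|_{H^r}$; (ii) $\|(\mathcal F_\tau-\mathcal G_\tau)(w_0)-(\mathcal F_\tau-\mathcal G_\tau)(v_0)\|_{H^r}\le C_R\,\tau^2\,\|w_0-v_0\|_{H^r}$.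
   Context: $\mathbb T=(0,2\pi)$ with periodic boundary conditions; $\mu$ is the constant coefficient of the nonlinearity. Fourier series: $f(x)=\sum_{k\in\mathbb Z}\hat f_k e^{ikx}$, so $\hat f_0$ is the mean of $f$. The regularized inverse derivative is $\partial_x^{-1}f(x)=\sum_{k\ne0}(ik)^{-1}\hat f_k e^{ikx}$ (zero mode set to $0$). $\|v\|_{L^2}^2=\int_{\mathbb T}|v|^2dx$. Exact fine propagator: $\mathcal F_\tau(v)$ is the value at time $\tau$ of the exact solution of the equation with initial value $v$ at time $0$.
   Formalization: In (ii) it is assumed that every initial value in B_R has an exact solution in C([0,T];H^r), and τ is restricted to 0<τ≤min(1,T), with the constant allowed to depend on T; for large R solutions can blow up before time 1, so F_τ is not defined on all of B_R. *)

theory Defs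
  imports "HOL-Analysis.Analysis"
begin

text \<open>
  Functions on the torus are represented by functions \<^typ>\<open>real \<Rightarrow> complex\<close> of which only the
  values on \<open>(0, 2\<pi>)\<close> matter, up to null sets; periodicity enters through the Fourier series.
\<close>

abbreviation torus :: "real measure" where
  "torus \<equiv> lebesgue_on {0<..<2*pi}"

definition square_integrable :: "(real \<Rightarrow> complex) \<Rightarrow> bool" where
  "square_integrable f \<longleftrightarrow>
     f \<in> borel_measurable torus \<and> integrable torus (\<lambda>x. (cmod (f x))\<^sup>2)"

definition l2norm :: "(real \<Rightarrow> complex) \<Rightarrow> real" where
  "l2norm f = sqrt (LINT x|torus. (cmod (f x))\<^sup>2)"

definition fourier :: "(real \<Rightarrow> complex) \<Rightarrow> int \<Rightarrow> complex" where
  "fourier f k = (LINT x|torus. f x * cis (- (of_int k * x))) / of_real (2 * pi)"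

definition sobolev :: "real \<Rightarrow> (real \<Rightarrow> complex) set" where
  "sobolev r = {f. square_integrable f \<and>
     (\<lambda>k::int. (1 + (of_int k)\<^sup>2) powr r * (cmod (fourier f k))\<^sup>2) summable_on UNIV}"

text \<open>
  The factor \<open>2\<pi>\<close> makes the norm for \<open>r = 0\<close> agree with \<^const>\<open>l2norm\<close>. The value is meaningful
  only on \<^term>\<open>sobolev r\<close>, since a divergent \<^const>\<open>infsum\<close> is \<open>0\<close>.
\<close>

definition hnorm :: "real \<Rightarrow> (real \<Rightarrow> complex) \<Rightarrow> real" where
  "hnorm r f =
     sqrt (2 * pi * (\<Sum>\<^sub>\<infinity>k::int. (1 + (of_int k)\<^sup>2) powr r * (cmod (fourier f k))\<^sup>2))"

definition sobolev_ball :: "real \<Rightarrow> real \<Rightarrow> (real \<Rightarrow> complex) set" where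
  "sobolev_ball r R = {v \<in> sobolev r. hnorm r v \<le> R}"

text \<open>
  The two Fourier multipliers below are pointwise (unconditionally convergent) sums. On
  \<^term>\<open>sobolev r\<close> with \<open>r > 1/2\<close> the Fourier coefficients are absolutely summable.
\<close>

definition inv_deriv :: "(real \<Rightarrow> complex) \<Rightarrow> real \<Rightarrow> complex" where
  "inv_deriv f x =
     (\<Sum>\<^sub>\<infinity>k\<in>UNIV - {0::int}. fourier f k / (\<i> * of_int k) * cis (of_int k * x))"

text \<open>The free group \<open>exp (i t \<partial>\<^sub>x\<^sup>2)\<close>, whose symbol is \<open>exp (- i t k\<^sup>2)\<close>.\<close>

definition schroedinger_group :: "real \<Rightarrow> (real \<Rightarrow> complex) \<Rightarrow> real \<Rightarrow> complex" where
  "schroedinger_group t f x =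
     (\<Sum>\<^sub>\<infinity>k::int. cis (- (t * (of_int k)\<^sup>2)) * fourier f k * cis (of_int k * x))"

text \<open>
  Solutions in \<open>C([0,T]; H\<^sup>r)\<close> of \<open>i \<partial>\<^sub>t u = - \<partial>\<^sub>x\<^sup>2 u + \<mu> |u|\<^sup>2\<close> with \<open>u(0) = v\<close>. For \<open>r < 2\<close> the term
  \<open>\<partial>\<^sub>x\<^sup>2 u\<close> need not be a function, so the equation is read in the sense of periodic distributions,
  that is, tested against every \<open>exp (- i k x)\<close>; it is solved here for the time derivative.
\<close>

definition exact_solution ::
  "complex \<Rightarrow> real \<Rightarrow> real \<Rightarrow> (real \<Rightarrow> complex) \<Rightarrow> (real \<Rightarrow> real \<Rightarrow> complex) \<Rightarrow> bool" where
  "exact_solution \<mu> r T v u \<longleftrightarrow>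
     u 0 = v \<and>
     (\<forall>t\<in>{0..T}. u t \<in> sobolev r) \<and>
     (\<forall>t\<in>{0..T}. ((\<lambda>s. hnorm r (\<lambda>x. u s x - u t x)) \<longlongrightarrow> 0) (at t within {0..T})) \<and>
     (\<forall>t\<in>{0..T}. \<forall>k::int.
        ((\<lambda>s. fourier (u s) k) has_vector_derivative
           - \<i> * ((of_int k)\<^sup>2 * fourier (u t) k
                  + \<mu> * fourier (\<lambda>x. of_real ((cmod (u t x))\<^sup>2)) k))
          (at t within {0..T}))"

text \<open>
  The solution is unique only up to null sets in \<open>x\<close>, hence \<^const>\<open>Eps\<close>. The value is meaningful only
  if a solution exists on the whole of \<open>[0,\<tau>]\<close>.
\<close>

definition fine_propagator ::
  "complex \<Rightarrow> real \<Rightarrow> real \<Rightarrow> (real \<Rightarrow> complex) \<Rightarrow> real \<Rightarrow> complex" where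
  "fine_propagator \<mu> r \<tau> v = (SOME u. exact_solution \<mu> r \<tau> v u) \<tau>"

definition Phi_c1 :: "complex \<Rightarrow> real \<Rightarrow> (real \<Rightarrow> complex) \<Rightarrow> real \<Rightarrow> complex" where
  "Phi_c1 \<mu> \<tau> v x =
     - \<i> * \<mu> * of_real \<tau> * cnj (fourier v 0) * schroedinger_group \<tau> v x
     - \<i> * \<mu> * of_real \<tau> / of_real (2 * pi) * of_real ((l2norm v)\<^sup>2)
     + \<i> * \<mu> * of_real \<tau> * of_real ((cmod (fourier v 0))\<^sup>2)
     + \<mu> / 2 * inv_deriv
         (\<lambda>y. schroedinger_group \<tau> v y
                * schroedinger_group (- \<tau>) (inv_deriv (\<lambda>z. cnj (v z))) y
              - schroedinger_group \<tau> (\<lambda>z. v z * inv_deriv (\<lambda>z'. cnj (v z')) z) y) x"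

definition coarse_propagator ::
  "complex \<Rightarrow> real \<Rightarrow> (real \<Rightarrow> complex) \<Rightarrow> real \<Rightarrow> complex" where
  "coarse_propagator \<mu> \<tau> v x = schroedinger_group \<tau> v x + Phi_c1 \<mu> \<tau> v x"

end

theory Submission
  imports Defs
begin

text \<open>
  In the interaction picture \<open>A\<^sub>k(t) = exp (i t k\<^sup>2) u\<^sub>k(t)\<close> the equation becomes
  \<open>A\<^sub>k' = - i \<mu> \<Sum>\<^sub>l exp (- 2 i t k l) A\<^bsub>k+l\<^esub> cnj A\<^sub>l\<close>, because \<open>k\<^sup>2 - (k + l)\<^sup>2 + l\<^sup>2 = - 2 k l\<close>.
  Freezing \<open>A\<close> at \<open>t = 0\<close> and integrating the phase exactly gives \<open>\<Phi>\<^bsub>c,1\<^esub>\<close> with no further error.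
  Hence \<open>\<Phi>\<^bsub>c,1\<^esub>\<close> is a bounded bilinear convolution with multipliers of size at most \<open>\<tau>\<close>, which is (i),
  and the local error has derivative of size \<open>O(t)\<close>, in a Lipschitz way, which is (ii).

  The constant in (ii) must be uniform over the ball although solutions are only assumed to exist.
  The ball of \<open>h\<^sup>r\<close> is compact in \<open>h\<^sup>s\<close> for \<open>1/2 < s < r\<close>; stability of solutions in \<open>h\<^sup>s\<close> gives bounds that
  are locally uniform in the initial value, hence uniform, and the tame product estimate
  lifts them to \<open>h\<^sup>r\<close>.
\<close>

section \<open>Weighted sequence spaces\<close>

text \<open>The obstacle is uniformity. The bilinear estimate bounds a solution by the size of its
  initial value only on a short interval, while \<open>\<tau>\<close> may be as large as
  \<open>min 1 T\<close>; existence up to \<open>T\<close> for each initial value separately gives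
  one bound per solution and none for the ball. Stability bounds all solutions that start near a
  given one. Compactness forces it to be used in the weaker norm, and the return to h^r is possible
  because each summand of the bilinear estimate carries the weight on one factor only, the other
  being measured in l^1.

  The bounds are proved for every solution on every interval \<open>{0..\<tau>}\<close>, since
  \<open>fine_propagator\<close> selects a solution separately for each \<open>\<tau>\<close>.

  No cancellation by oscillation is exploited: all multipliers are estimated by absolute values.

  Completeness of the trigonometric system enters because a function in \<open>sobolev r\<close>
  agrees with its Fourier series only almost everywhere, while the equation involves the Fourier
  coefficients of |u|^2.\<close>

definition weight :: "real \<Rightarrow> int \<Rightarrow> real" where
  "weight r k = (1 + (of_int k)\<^sup>2) powr (r / 2)"

text \<open>Bounding all finite sections makes summability part of the assertion.\<close>

definition hbound :: "real \<Rightarrow> (int \<Rightarrow> complex) \<Rightarrow> real \<Rightarrow> bool" where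
  "hbound r a M \<longleftrightarrow> (\<forall>S. finite S \<longrightarrow> L2_set (\<lambda>k. weight r k * cmod (a k)) S \<le> M)"

definition l1bound :: "(int \<Rightarrow> complex) \<Rightarrow> real \<Rightarrow> bool" where
  "l1bound a M \<longleftrightarrow> (\<forall>S. finite S \<longrightarrow> (\<Sum>k\<in>S. cmod (a k)) \<le> M)"

lemma weight_pos: "weight r k > 0"
  unfolding weight_def by (smt (verit) powr_gt_zero zero_le_power2)

lemma weight_nonneg [simp]: "weight r k \<ge> 0"
  using weight_pos[of r k] by simp

lemma weight_minus [simp]: "weight r (- k) = weight r k"
  by (simp add: weight_def)

lemma weight_square: "(weight r k)\<^sup>2 = (1 + (of_int k)\<^sup>2) powr r"
  by (simp add: weight_def power2_eq_square flip: powr_add)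

lemma weight_mono: "s \<le> r \<Longrightarrow> weight s k \<le> weight r k"
  unfolding weight_def by (intro powr_mono) auto

text \<open>The larger of |k| and |l| is at least half of |k + l|. This replaces a Leibniz rule for
  fractional \<open>r\<close>: the weight at the output frequency of a product is passed to one of
  the two factors.\<close>

lemma weight_add:
  assumes "r \<ge> 0"
  shows "weight r (k + l) \<le> 4 powr (r / 2) * (weight r k + weight r l)"
proof -
  have *: "1 + (real_of_int (k + l))\<^sup>2 \<le> 4 * max (1 + (real_of_int k)\<^sup>2) (1 + (real_of_int l)\<^sup>2)"
    using sum_squares_bound[of "real_of_int k" "real_of_int l"] by (simp add: power2_sum max_def)
  have "weight r (k + l) \<le> (4 * max (1 + (real_of_int k)\<^sup>2) (1 + (real_of_int l)\<^sup>2)) powr (r / 2)"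
    unfolding weight_def by (rule powr_mono2) (use assms * in auto)
  also have "\<dots> = 4 powr (r / 2) * max (weight r k) (weight r l)"
    using assms by (simp add: powr_mult weight_def max_def powr_mono2) (smt (verit) powr_mono2 divide_nonneg_nonneg zero_le_power2)
  also have "\<dots> \<le> 4 powr (r / 2) * (weight r k + weight r l)"
    by (intro mult_left_mono) (auto simp: max_def)
  finally show ?thesis .
qed

lemma L2_set_sum_le:
  assumes "finite L"
  shows "L2_set (\<lambda>k. \<Sum>l\<in>L. f l k) S \<le> (\<Sum>l\<in>L. L2_set (f l) S)"
  using assms
proof (induction L rule: finite_induct)
  case empty
  then show ?case by (simp add: L2_set_0')
next
  case (insert x L)
  then show ?case
    using L2_set_triangle_ineq[of "f x" "\<lambda>k. \<Sum>l\<in>L. f l k" S] by simp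
qed

lemma L2_set_reindex: "inj_on h S \<Longrightarrow> L2_set (\<lambda>k. f (h k)) S = L2_set f (h ` S)"
  by (simp add: L2_set_def sum.reindex o_def)

lemma hboundD: "hbound r a M \<Longrightarrow> finite S \<Longrightarrow> L2_set (\<lambda>k. weight r k * cmod (a k)) S \<le> M"
  by (simp add: hbound_def)

lemma hbound_nonneg: "hbound r a M \<Longrightarrow> M \<ge> 0"
  using hboundD[of r a M "{}"] by simp

lemma hbound_mono: "hbound r a M \<Longrightarrow> M \<le> N \<Longrightarrow> hbound r a N"
  unfolding hbound_def by force

lemma hbound_coeff: "hbound r a M \<Longrightarrow> weight r k * cmod (a k) \<le> M"
  using hboundD[of r a M "{k}"] by simp

lemma hbound_norm_mono:
  assumes "hbound r a M" "\<And>k. cmod (b k) \<le> cmod (a k)"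
  shows "hbound r b M"
  unfolding hbound_def
proof (intro allI impI)
  fix S :: "int set" assume "finite S"
  have "L2_set (\<lambda>k. weight r k * cmod (b k)) S \<le> L2_set (\<lambda>k. weight r k * cmod (a k)) S"
    using assms(2) by (intro L2_set_mono mult_left_mono) auto
  then show "L2_set (\<lambda>k. weight r k * cmod (b k)) S \<le> M"
    using hboundD[OF assms(1) \<open>finite S\<close>] by linarith
qed

lemma hbound_weaken:
  assumes "hbound r a M" "s \<le> r"
  shows "hbound s a M"
  unfolding hbound_def
proof (intro allI impI)
  fix S :: "int set" assume "finite S"
  have "L2_set (\<lambda>k. weight s k * cmod (a k)) S \<le> L2_set (\<lambda>k. weight r k * cmod (a k)) S"
    using weight_mono[OF assms(2)] by (intro L2_set_mono mult_right_mono) auto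
  then show "L2_set (\<lambda>k. weight s k * cmod (a k)) S \<le> M"
    using hboundD[OF assms(1) \<open>finite S\<close>] by linarith
qed

lemma hbound_add:
  assumes "hbound r a M" "hbound r b N"
  shows "hbound r (\<lambda>k. a k + b k) (M + N)"
  unfolding hbound_def
proof (intro allI impI)
  fix S :: "int set" assume "finite S"
  have "L2_set (\<lambda>k. weight r k * cmod (a k + b k)) S
      \<le> L2_set (\<lambda>k. weight r k * cmod (a k) + weight r k * cmod (b k)) S"
    by (intro L2_set_mono) (auto simp: norm_triangle_ineq simp flip: distrib_left intro!: mult_left_mono)
  also have "\<dots> \<le> L2_set (\<lambda>k. weight r k * cmod (a k)) S + L2_set (\<lambda>k. weight r k * cmod (b k)) S"
    by (rule L2_set_triangle_ineq)
  also have "\<dots> \<le> M + N"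
    using hboundD[OF assms(1) \<open>finite S\<close>] hboundD[OF assms(2) \<open>finite S\<close>] by linarith
  finally show "L2_set (\<lambda>k. weight r k * cmod (a k + b k)) S \<le> M + N" .
qed

lemma hbound_cmult:
  assumes "hbound r a M"
  shows "hbound r (\<lambda>k. c * a k) (cmod c * M)"
  unfolding hbound_def
proof (intro allI impI)
  fix S :: "int set" assume "finite S"
  have "L2_set (\<lambda>k. weight r k * cmod (c * a k)) S = cmod c * L2_set (\<lambda>k. weight r k * cmod (a k)) S"
    by (subst L2_set_right_distrib) (auto simp: norm_mult mult_ac)
  also have "\<dots> \<le> cmod c * M"
    using hboundD[OF assms \<open>finite S\<close>] by (intro mult_left_mono) auto
  finally show "L2_set (\<lambda>k. weight r k * cmod (c * a k)) S \<le> cmod c * M" .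
qed

lemma hbound_norm_cong: "(\<And>k. cmod (b k) = cmod (a k)) \<Longrightarrow> hbound r b M \<longleftrightarrow> hbound r a M"
  by (simp add: hbound_def)

lemma hbound_minus:
  assumes "hbound r a M" "hbound r b N"
  shows "hbound r (\<lambda>k. a k - b k) (M + N)"
proof -
  have "hbound r (\<lambda>k. - b k) N"
    using assms(2) by (simp add: hbound_def)
  from hbound_add[OF assms(1) this] show ?thesis by simp
qed

lemma hbound_zero [simp]: "hbound r (\<lambda>k. 0) 0"
  by (simp add: hbound_def L2_set_0')

lemma hbound_le_epsilon:
  assumes "\<And>e. e > 0 \<Longrightarrow> hbound r a (M + e)"
  shows "hbound r a M"
  unfolding hbound_def
  by (intro allI impI, rule field_le_epsilon) (use assms in \<open>simp add: hbound_def\<close>)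

text \<open>A finite section of the norm is continuous in finitely many coordinates, so
  coordinatewise limits suffice, as in Fatou's lemma. This carries bounds for partial sums over to
  \<open>bilin\<close>.\<close>

lemma hbound_tendsto:
  assumes "F \<noteq> bot" "\<And>k. ((\<lambda>x. a x k) \<longlongrightarrow> b k) F" "eventually (\<lambda>x. hbound r (a x) M) F"
  shows "hbound r b M"
  unfolding hbound_def
proof (intro allI impI)
  fix S :: "int set" assume "finite S"
  have "((\<lambda>x. L2_set (\<lambda>k. weight r k * cmod (a x k)) S) \<longlongrightarrow> L2_set (\<lambda>k. weight r k * cmod (b k)) S) F"
    unfolding L2_set_def by (intro tendsto_intros assms)
  moreover have "eventually (\<lambda>x. L2_set (\<lambda>k. weight r k * cmod (a x k)) S \<le> M) F"
    using assms(3) by eventually_elim (use \<open>finite S\<close> hboundD in blast)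
  ultimately show "L2_set (\<lambda>k. weight r k * cmod (b k)) S \<le> M"
    using assms(1) tendsto_upperbound by blast
qed

section \<open>The embedding of h^r into l^1 for r > 1/2\<close>

lemma summable_int_powr:
  assumes "r > 1/2"
  shows "(\<lambda>k::int. (1 + (of_int k)\<^sup>2) powr (- r) :: real) summable_on UNIV"
proof -
  define f where "f = (\<lambda>k::int. (1 + (of_int k)\<^sup>2) powr (- r) :: real)"
  have f_nonneg: "f k \<ge> 0" for k by (simp add: f_def)
  have "summable (\<lambda>n. real n powr (- 2 * r))"
    using assms by (subst summable_real_powr_iff) auto
  then have "summable (\<lambda>n. f (int n))"
  proof (rule summable_comparison_test_ev[rotated])
    show "\<forall>\<^sub>F n in sequentially. norm (f (int n)) \<le> real n powr (- 2 * r)"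
      using eventually_gt_at_top[of 0]
    proof eventually_elim
      case (elim n)
      have "f (int n) \<le> ((real n)\<^sup>2) powr (- r)"
        unfolding f_def using elim assms by (intro powr_mono2') auto
      also have "\<dots> = real n powr (- 2 * r)"
        using elim by (simp add: powr_powr flip: powr_numeral)
      finally show ?case using f_nonneg by simp
    qed
  qed
  then have "(\<lambda>n. f (int n)) summable_on UNIV"
    by (intro summable_nonneg_imp_summable_on) (auto simp: f_nonneg)
  then have 1: "f summable_on (range int)"
    by (subst summable_on_reindex) (auto simp: o_def)
  have "f summable_on (uminus ` range int)"
    by (subst summable_on_reindex) (use 1 in \<open>auto simp: o_def f_def\<close>)
  from summable_on_union[OF 1 this] have "f summable_on (range int \<union> uminus ` range int)" .
  moreover have "range int \<union> uminus ` range int = UNIV"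
  proof -
    have "k \<in> range int \<union> uminus ` range int" for k
      by (cases k rule: int_cases2) auto
    then show ?thesis by auto
  qed
  ultimately show ?thesis by (simp add: f_def)
qed

definition embed_const :: "real \<Rightarrow> real" where
  "embed_const r = sqrt (\<Sum>\<^sub>\<infinity>k::int. (1 + (of_int k)\<^sup>2) powr (- r))"

lemma embed_const_nonneg: "embed_const r \<ge> 0"
  unfolding embed_const_def by (simp add: infsum_nonneg)

text \<open>Cauchy-Schwarz against the inverse weights, whose l^2 norm is
  \<open>embed_const r\<close>; r > 1/2 makes their squares summable.\<close>

lemma hbound_imp_l1bound:
  assumes "r > 1/2" "hbound r a M"
  shows "l1bound a (embed_const r * M)"
  unfolding l1bound_def
proof (intro allI impI)
  fix S :: "int set" assume "finite S"
  have "(\<Sum>k\<in>S. cmod (a k)) = (\<Sum>k\<in>S. \<bar>inverse (weight r k)\<bar> * \<bar>weight r k * cmod (a k)\<bar>)"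
    using weight_pos by (intro sum.cong) (auto simp: abs_mult field_simps abs_of_pos less_imp_neq[THEN not_sym])
  also have "\<dots> \<le> L2_set (\<lambda>k. inverse (weight r k)) S * L2_set (\<lambda>k. weight r k * cmod (a k)) S"
    by (rule L2_set_mult_ineq)
  also have "\<dots> \<le> embed_const r * M"
  proof (intro mult_mono embed_const_nonneg hboundD[OF assms(2) \<open>finite S\<close>] L2_set_nonneg)
    have "(\<Sum>k\<in>S. (inverse (weight r k))\<^sup>2) = (\<Sum>k\<in>S. (1 + (of_int k)\<^sup>2) powr (- r))"
      by (simp add: power_inverse weight_square powr_minus)
    also have "\<dots> \<le> (\<Sum>\<^sub>\<infinity>k::int. (1 + (of_int k)\<^sup>2) powr (- r))"
      by (rule finite_sum_le_infsum[OF summable_int_powr[OF assms(1)] \<open>finite S\<close>]) auto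
    finally show "L2_set (\<lambda>k. inverse (weight r k)) S \<le> embed_const r"
      by (simp add: L2_set_def embed_const_def)
  qed
  finally show "(\<Sum>k\<in>S. cmod (a k)) \<le> embed_const r * M" .
qed

lemma l1bound_summable: "l1bound a M \<Longrightarrow> (\<lambda>k. cmod (a k)) summable_on UNIV"
  unfolding l1bound_def by (intro nonneg_bdd_above_summable_on) (auto intro!: bdd_aboveI2)

lemma l1bound_infsum: "l1bound a M \<Longrightarrow> (\<Sum>\<^sub>\<infinity>k. cmod (a k)) \<le> M"
  using infsum_le_finite_sums[OF l1bound_summable] by (auto simp: l1bound_def)

section \<open>The bilinear convolution operators\<close>

text \<open>With constant symbol 1 and absolutely summable \<open>a\<close>, \<open>b\<close> this
  is the \<open>k\<close>-th Fourier coefficient of f times the conjugate of g, where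
  \<open>a\<close>, \<open>b\<close> are the coefficients of f, g: the conjugated mode
  \<open>l\<close> contributes frequency \<open>- l\<close>.\<close>

definition bilin ::
  "(int \<Rightarrow> int \<Rightarrow> complex) \<Rightarrow> (int \<Rightarrow> complex) \<Rightarrow> (int \<Rightarrow> complex) \<Rightarrow> int \<Rightarrow> complex" where
  "bilin m a b k = (\<Sum>\<^sub>\<infinity>l. m k l * (a (k + l) * cnj (b l)))"

lemma bilin_terms_summable:
  assumes "\<And>k l. cmod (m k l) \<le> c" "l1bound a A" "l1bound b B"
  shows "(\<lambda>l. norm (m k l * (a (k + l) * cnj (b l)))) summable_on UNIV"
proof (rule summable_on_comparison_test)
  show "(\<lambda>l. (c * A) * cmod (b l)) summable_on UNIV"
    by (intro summable_on_cmult_right l1bound_summable[OF assms(3)])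
  have "cmod (a j) \<le> A" for j
    using assms(2)[unfolded l1bound_def, rule_format, of "{j}"] by simp
  moreover have "c \<ge> 0" using assms(1) norm_ge_zero order_trans by blast
  ultimately show "norm (m k l * (a (k + l) * cnj (b l))) \<le> (c * A) * cmod (b l)" for l
    using assms(1) by (simp add: norm_mult mult.assoc[symmetric] mult_mono mult_right_mono)
qed auto

lemma bilin_has_sum:
  assumes "\<And>k l. cmod (m k l) \<le> c" "l1bound a A" "l1bound b B"
  shows "((\<lambda>l. m k l * (a (k + l) * cnj (b l))) has_sum bilin m a b k) UNIV"
  unfolding bilin_def
  by (rule has_sum_infsum[OF abs_summable_summable[OF bilin_terms_summable[OF assms]]])

text \<open>A tame form of Young's inequality. \<open>weight_add\<close> splits the sum in two; in
  each half one factor keeps the weight and the other enters through its l^1 norm alone, and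
  Minkowski's inequality is applied to the translates of the weighted factor. Everything is done for
  finite \<open>L\<close> and \<open>S\<close>, the limit in \<open>L\<close> being left to
  \<open>hbound_tendsto\<close>.\<close>

lemma bilin_hbound:
  assumes r: "r \<ge> 0" and m: "\<And>k l. cmod (m k l) \<le> c"
    and a: "hbound r a A" "l1bound a A1" and b: "hbound r b B" "l1bound b B1"
  shows "hbound r (bilin m a b) (c * 4 powr (r / 2) * (A * B1 + A1 * B))"
proof (rule hbound_tendsto)
  show "finite_subsets_at_top (UNIV :: int set) \<noteq> bot" by simp
  show "((\<lambda>L. \<Sum>l\<in>L. m k l * (a (k + l) * cnj (b l))) \<longlongrightarrow> bilin m a b k) (finite_subsets_at_top UNIV)" for k
    using bilin_has_sum[OF m a(2) b(2)] by (simp add: has_sum_def)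
  show "\<forall>\<^sub>F L in finite_subsets_at_top UNIV.
      hbound r (\<lambda>k. \<Sum>l\<in>L. m k l * (a (k + l) * cnj (b l))) (c * 4 powr (r / 2) * (A * B1 + A1 * B))"
  proof (rule eventually_finite_subsets_at_top_weakI)
    fix L :: "int set" assume L: "finite L"
    have c: "c \<ge> 0" using m norm_ge_zero order_trans by blast
    define C where "C = c * 4 powr (r / 2)"
    have C: "C \<ge> 0" using c by (simp add: C_def)
    show "hbound r (\<lambda>k. \<Sum>l\<in>L. m k l * (a (k + l) * cnj (b l))) (c * 4 powr (r / 2) * (A * B1 + A1 * B))"
      unfolding hbound_def C_def[symmetric]
    proof (intro allI impI)
      fix S :: "int set" assume S: "finite S"
      \<comment> \<open>\<open>f\<close> puts the weight on \<open>a\<close> and is summed over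
        \<open>l\<close>; \<open>g\<close> puts it on \<open>b\<close> and is re-indexed by
        \<open>j = k + l\<close>. As functions of \<open>k\<close> both are then a scalar times a
        translated or reflected weighted sequence. \<open>J\<close> collects the values of
        \<open>j\<close> that occur.\<close>
      define f where "f = (\<lambda>l k. cmod (b l) * (weight r (k + l) * cmod (a (k + l))))"
      define g where "g = (\<lambda>j k. cmod (a j) * (weight r (j - k) * cmod (b (j - k))))"
      define J where "J = (\<lambda>(k, l). k + l) ` (S \<times> L)"
      have J: "finite J" using S L by (simp add: J_def)
      have termwise: "weight r k * cmod (m k l * (a (k + l) * cnj (b l))) \<le> C * (f l k + g (k + l) k)" for k l
      proof -
        have "weight r k \<le> 4 powr (r / 2) * (weight r (k + l) + weight r l)"
          using weight_add[OF r, of "k + l" "- l"] by simp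
        then have "weight r k * cmod (m k l * (a (k + l) * cnj (b l)))
           \<le> (4 powr (r / 2) * (weight r (k + l) + weight r l)) * (c * (cmod (a (k + l)) * cmod (b l)))"
          unfolding norm_mult using m c by (intro mult_mono) auto
        then show ?thesis by (simp add: C_def f_def g_def algebra_simps)
      qed
      have 1: "weight r k * cmod (\<Sum>l\<in>L. m k l * (a (k + l) * cnj (b l)))
          \<le> C * ((\<Sum>l\<in>L. f l k) + (\<Sum>j\<in>J. g j k))" if "k \<in> S" for k
      proof -
        have "weight r k * cmod (\<Sum>l\<in>L. m k l * (a (k + l) * cnj (b l)))
            \<le> weight r k * (\<Sum>l\<in>L. cmod (m k l * (a (k + l) * cnj (b l))))"
          by (intro mult_left_mono norm_sum) auto
        also have "\<dots> \<le> (\<Sum>l\<in>L. C * (f l k + g (k + l) k))"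
          unfolding sum_distrib_left by (intro sum_mono termwise)
        also have "\<dots> = C * ((\<Sum>l\<in>L. f l k) + (\<Sum>l\<in>L. g (k + l) k))"
          by (simp add: sum.distrib flip: sum_distrib_left)
        also have "(\<Sum>l\<in>L. g (k + l) k) = (\<Sum>j\<in>(+) k ` L. g j k)"
          by (subst sum.reindex) auto
        also have "\<dots> \<le> (\<Sum>j\<in>J. g j k)"
          by (intro sum_mono2 J) (auto simp: J_def g_def that)
        finally show ?thesis using C by (simp add: mult_left_mono)
      qed
      have "L2_set (\<lambda>k. weight r k * cmod (\<Sum>l\<in>L. m k l * (a (k + l) * cnj (b l)))) S
          \<le> L2_set (\<lambda>k. C * ((\<Sum>l\<in>L. f l k) + (\<Sum>j\<in>J. g j k))) S"
        by (intro L2_set_mono 1) auto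
      also have "\<dots> = C * L2_set (\<lambda>k. (\<Sum>l\<in>L. f l k) + (\<Sum>j\<in>J. g j k)) S"
        by (simp add: L2_set_right_distrib C)
      also have "\<dots> \<le> C * (L2_set (\<lambda>k. \<Sum>l\<in>L. f l k) S + L2_set (\<lambda>k. \<Sum>j\<in>J. g j k) S)"
        by (intro mult_left_mono L2_set_triangle_ineq C)
      also have "\<dots> \<le> C * ((\<Sum>l\<in>L. L2_set (f l) S) + (\<Sum>j\<in>J. L2_set (g j) S))"
        by (intro mult_left_mono add_mono L2_set_sum_le C L J)
      also have "\<dots> \<le> C * ((\<Sum>l\<in>L. cmod (b l) * A) + (\<Sum>j\<in>J. cmod (a j) * B))"
      proof (intro mult_left_mono add_mono sum_mono C)
        fix l
        have "L2_set (f l) S = cmod (b l) * L2_set (\<lambda>k. weight r (k + l) * cmod (a (k + l))) S"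
          unfolding f_def by (simp add: L2_set_right_distrib)
        also have "L2_set (\<lambda>k. weight r (k + l) * cmod (a (k + l))) S
            = L2_set (\<lambda>k. weight r k * cmod (a k)) ((\<lambda>k. k + l) ` S)"
          by (rule L2_set_reindex[of "\<lambda>k. k + l" S]) (auto simp: inj_on_def)
        also have "cmod (b l) * \<dots> \<le> cmod (b l) * A"
          by (intro mult_left_mono hboundD[OF a(1)]) (use S in auto)
        finally show "L2_set (f l) S \<le> cmod (b l) * A" .
      next
        fix j
        have "L2_set (g j) S = cmod (a j) * L2_set (\<lambda>k. weight r (j - k) * cmod (b (j - k))) S"
          unfolding g_def by (simp add: L2_set_right_distrib)
        also have "L2_set (\<lambda>k. weight r (j - k) * cmod (b (j - k))) S
            = L2_set (\<lambda>k. weight r k * cmod (b k)) ((\<lambda>k. j - k) ` S)"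
          by (rule L2_set_reindex[of "\<lambda>k. j - k" S]) (auto simp: inj_on_def)
        also have "cmod (a j) * \<dots> \<le> cmod (a j) * B"
          by (intro mult_left_mono hboundD[OF b(1)]) (use S in auto)
        finally show "L2_set (g j) S \<le> cmod (a j) * B" .
      qed
      also have "\<dots> \<le> C * (B1 * A + A1 * B)"
        unfolding sum_distrib_right[symmetric]
        using a(2) b(2) L J hbound_nonneg[OF a(1)] hbound_nonneg[OF b(1)]
        by (intro mult_left_mono add_mono mult_right_mono C) (auto simp: l1bound_def)
      finally show "L2_set (\<lambda>k. weight r k * cmod (\<Sum>l\<in>L. m k l * (a (k + l) * cnj (b l)))) S
          \<le> C * (A * B1 + A1 * B)" by (simp add: mult.commute)
    qed
  qed
qed

text \<open>The factor 2 adds the two halves of \<open>bilin_hbound\<close> after both l^1 norms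
  have been replaced by \<open>embed_const r\<close> times the weighted norm.\<close>

definition bilin_const :: "real \<Rightarrow> real" where
  "bilin_const r = 4 powr (r / 2) * (2 * embed_const r)"

lemma bilin_const_nonneg: "bilin_const r \<ge> 0"
  by (simp add: bilin_const_def embed_const_nonneg)

lemma bilin_bound:
  assumes r: "r > 1/2" and m: "\<And>k l. cmod (m k l) \<le> c"
    and a: "hbound r a A" and b: "hbound r b B"
  shows "hbound r (bilin m a b) (c * bilin_const r * A * B)"
  using bilin_hbound[OF _ m a hbound_imp_l1bound[OF r a] b hbound_imp_l1bound[OF r b]] r
  by (simp add: bilin_const_def algebra_simps)

lemma bilin_diff:
  assumes "\<And>k l. cmod (m k l) \<le> c" "l1bound a A" "l1bound a' A'" "l1bound b B" "l1bound b' B'"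
  shows "bilin m a b k - bilin m a' b' k
       = bilin m (\<lambda>k. a k - a' k) b k + bilin m a' (\<lambda>k. b k - b' k) k"
proof -
  have l1_diff: "l1bound (\<lambda>k. a k - a' k) (A + A')" if "l1bound a A" "l1bound a' A'" for a a' A A'
    unfolding l1bound_def
  proof (intro allI impI)
    fix S :: "int set" assume "finite S"
    have "(\<Sum>k\<in>S. cmod (a k - a' k)) \<le> (\<Sum>k\<in>S. cmod (a k) + cmod (a' k))"
      by (intro sum_mono norm_triangle_ineq4)
    then show "(\<Sum>k\<in>S. cmod (a k - a' k)) \<le> A + A'"
      using that \<open>finite S\<close> unfolding l1bound_def sum.distrib by (meson add_mono order_trans)
  qed
  have "((\<lambda>l. m k l * ((a (k + l) - a' (k + l)) * cnj (b l)) + m k l * (a' (k + l) * cnj (b l - b' l)))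
      has_sum (bilin m (\<lambda>k. a k - a' k) b k + bilin m a' (\<lambda>k. b k - b' k) k)) UNIV"
    by (rule has_sum_add[OF bilin_has_sum[where m=m, OF assms(1) l1_diff[OF assms(2,3)] assms(4)]
          bilin_has_sum[where m=m, OF assms(1) assms(3) l1_diff[OF assms(4,5)]]])
  moreover have "((\<lambda>l. m k l * (a (k + l) * cnj (b l)) - m k l * (a' (k + l) * cnj (b' l)))
      has_sum (bilin m a b k - bilin m a' b' k)) UNIV"
    by (rule has_sum_add[OF bilin_has_sum[where m=m, OF assms(1,2,4)] has_sum_uminusI[OF bilin_has_sum[where m=m, OF assms(1,3,5)]], simplified])
  ultimately show ?thesis
    by (intro has_sum_unique[where f = "\<lambda>l. m k l * (a (k + l) * cnj (b l)) - m k l * (a' (k + l) * cnj (b' l))"])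
      (simp_all add: algebra_simps)
qed

lemma bilin_diff_hbound:
  assumes "r > 1/2" "\<And>k l. cmod (m k l) \<le> c"
    "hbound r a A" "hbound r a' A'" "hbound r b B" "hbound r b' B'"
  shows "bilin m a b k - bilin m a' b' k
       = bilin m (\<lambda>k. a k - a' k) b k + bilin m a' (\<lambda>k. b k - b' k) k"
  by (rule bilin_diff[OF assms(2) assms(3-6)[THEN hbound_imp_l1bound[OF assms(1)]]])

section \<open>Oscillatory multipliers\<close>

definition osc :: "real \<Rightarrow> int \<Rightarrow> int \<Rightarrow> complex" where
  "osc t k l = cis (- (2 * of_int (k * l)) * t)"

text \<open>The primitive of \<open>osc\<close> in \<open>t\<close> that vanishes at
  \<open>t = 0\<close>. For \<open>k * l = 0\<close> the phase is constant, which gives the separate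
  first case.\<close>

definition prim :: "real \<Rightarrow> int \<Rightarrow> int \<Rightarrow> complex" where
  "prim t k l = (if k * l = 0 then of_real t else (osc t k l - 1) / (- 2 * \<i> * of_int (k * l)))"

lemma has_vector_derivative_cis_mult:
  "((\<lambda>t. cis (c * t)) has_vector_derivative (\<i> * of_real c * cis (c * t))) (at t within S)"
proof -
  have "((\<lambda>z. exp (\<i> * of_real c * z)) has_field_derivative (\<i> * of_real c * exp (\<i> * of_real c * of_real t)))
      (at (of_real t))"
    by (auto intro!: derivative_eq_intros)
  from has_vector_derivative_real_field[OF this, of S] show ?thesis
    by (simp add: cis_conv_exp mult.assoc)
qed

lemma norm_osc [simp]: "cmod (osc t k l) = 1"
  by (simp add: osc_def)

lemma prim_0 [simp]: "prim 0 k l = 0"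
  by (simp add: prim_def osc_def)

lemma bilin_prim_0 [simp]: "bilin (prim 0) a b k = 0"
  by (simp add: bilin_def)

lemma prim_has_vector_derivative:
  "((\<lambda>t. prim t k l) has_vector_derivative osc t k l) (at t within S)"
proof (cases "k * l = 0")
  case True
  then show ?thesis
    unfolding prim_def osc_def by (auto intro!: derivative_eq_intros)
next
  case False
  have "((\<lambda>t. (osc t k l - 1) * inverse (- 2 * \<i> * of_int (k * l))) has_vector_derivative
      (\<i> * of_real (- (2 * of_int (k * l))) * osc t k l) * inverse (- 2 * \<i> * of_int (k * l))) (at t within S)"
    unfolding osc_def
    by (intro has_vector_derivative_mult_left) (simp only: has_vector_derivative_diff_const has_vector_derivative_cis_mult)
  with False show ?thesis
    by (simp add: prim_def divide_inverse[symmetric] field_simps)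
qed

text \<open>Integrating a unimodular function gives a bound that does not see the denominator
  \<open>k * l\<close> and is uniform in \<open>k\<close> and \<open>l\<close>. With
  \<open>s = 0\<close> it yields the factor \<open>\<tau>\<close> in (i); for difference quotients
  it yields the majorant in the termwise differentiation below.\<close>

lemma norm_prim_diff: "cmod (prim t k l - prim s k l) \<le> \<bar>t - s\<bar>"
proof -
  have *: "cmod (prim t k l - prim s k l) \<le> t - s" if "s < t" for s t
  proof (rule differentiable_bound_general[OF that])
    show "continuous_on {s..t} (\<lambda>t. prim t k l)"
      by (rule continuous_on_vector_derivative) (rule prim_has_vector_derivative)
    show "continuous_on {s..t} (\<lambda>t. t)" by (intro continuous_intros)
    show "((\<lambda>t. prim t k l) has_vector_derivative osc x k l) (at x)" for x
      by (rule prim_has_vector_derivative)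
    show "((\<lambda>t. t) has_vector_derivative 1) (at x)" for x :: real
      by (rule has_vector_derivative_id)
  qed auto
  show ?thesis
    using *[of s t] *[of t s] by (cases s t rule: linorder_cases) (auto simp: norm_minus_commute)
qed

lemma norm_prim: "t \<ge> 0 \<Longrightarrow> cmod (prim t k l) \<le> t"
  using norm_prim_diff[of t k l 0] by simp

lemma has_vector_derivative_iff_quotient:
  fixes f :: "real \<Rightarrow> 'a::real_normed_vector"
  shows "(f has_vector_derivative D) (at t) \<longleftrightarrow> ((\<lambda>s. inverse (s - t) *\<^sub>R (f s - f t)) \<longlongrightarrow> D) (at t)"
proof -
  have eq: "norm (f s - f t - (s - t) *\<^sub>R D) / norm (s - t) = norm (inverse (s - t) *\<^sub>R (f s - f t) - D)"
    if "s \<noteq> t" for s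
  proof -
    have "inverse (s - t) *\<^sub>R (f s - f t) - D = inverse (s - t) *\<^sub>R (f s - f t - (s - t) *\<^sub>R D)"
      using that by (simp add: scaleR_diff_right)
    then show ?thesis by (simp add: divide_inverse)
  qed
  have "(f has_vector_derivative D) (at t) \<longleftrightarrow>
      ((\<lambda>s. norm (f s - f t - (s - t) *\<^sub>R D) / norm (s - t)) \<longlongrightarrow> 0) (at t)"
    unfolding has_vector_derivative_def has_derivative_iff_norm
    by (simp add: bounded_linear_scaleR_left)
  also have "\<dots> \<longleftrightarrow> ((\<lambda>s. norm (inverse (s - t) *\<^sub>R (f s - f t) - D)) \<longlongrightarrow> 0) (at t)"
    by (intro filterlim_cong refl eventually_at_filter[THEN iffD2] always_eventually allI impI eq)
  also have "\<dots> \<longleftrightarrow> ((\<lambda>s. inverse (s - t) *\<^sub>R (f s - f t)) \<longlongrightarrow> D) (at t)"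
    by (simp add: tendsto_norm_zero_iff LIM_zero_iff)
  finally show ?thesis .
qed

text \<open>The difference quotients in \<open>t\<close>, extended continuously, are dominated by a summable sequence.\<close>

lemma bilin_prim_has_vector_derivative:
  assumes a: "l1bound a A" and b: "l1bound b B"
  shows "((\<lambda>t. bilin (prim t) a b k) has_vector_derivative bilin (osc t) a b k) (at t within S)"
proof -
  define c where "c = (\<lambda>l. a (k + l) * cnj (b l))"
  define q where "q = (\<lambda>l s. if s = t then osc t k l else inverse (s - t) *\<^sub>R (prim s k l - prim t k l))"
  have csum: "(\<lambda>l. cmod (c l)) summable_on UNIV"
    using bilin_terms_summable[of "\<lambda>_ _. 1" 1 a A b B k] a b by (simp add: c_def)
  have q_cont: "(q l \<longlongrightarrow> q l t) (at t)" for l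
  proof -
    have "((\<lambda>s. inverse (s - t) *\<^sub>R (prim s k l - prim t k l)) \<longlongrightarrow> osc t k l) (at t)"
      using prim_has_vector_derivative[of k l t UNIV] by (simp add: has_vector_derivative_iff_quotient)
    then have "(q l \<longlongrightarrow> osc t k l) (at t)"
      by (rule Lim_transform_eventually) (simp add: q_def eventually_at_filter)
    then show ?thesis by (simp add: q_def)
  qed
  have q_bound: "cmod (q l s) \<le> 1" for l s
    using norm_prim_diff[of s k l t] by (auto simp: q_def divide_simps)
  have "uniform_limit UNIV (\<lambda>X s. \<Sum>l\<in>X. q l s * c l) (\<lambda>s. \<Sum>\<^sub>\<infinity>l. q l s * c l) (finite_subsets_at_top UNIV)"
    by (rule Weierstrass_m_test_general[OF _ csum]) (auto simp: norm_mult q_bound mult_left_le_one_le)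
  then have lim: "((\<lambda>s. \<Sum>\<^sub>\<infinity>l. q l s * c l) \<longlongrightarrow> (\<Sum>\<^sub>\<infinity>l. q l t * c l)) (at t)"
    by (rule swap_uniform_limit[where F = "finite_subsets_at_top UNIV" and f = "\<lambda>X s. \<Sum>l\<in>X. q l s * c l" and g = "\<lambda>X. \<Sum>l\<in>X. q l t * c l", rotated 2])
      (auto intro!: always_eventually tendsto_intros q_cont abs_summable_summable[THEN infsum_tendsto] summable_on_comparison_test[OF csum]
         simp: norm_mult q_bound mult_left_le_one_le)
  have at_t: "(\<Sum>\<^sub>\<infinity>l. q l t * c l) = bilin (osc t) a b k"
    by (simp add: q_def bilin_def c_def)
  have quot: "(\<Sum>\<^sub>\<infinity>l. q l s * c l) = inverse (s - t) *\<^sub>R (bilin (prim s) a b k - bilin (prim t) a b k)"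
    if "s \<noteq> t" for s
  proof -
    have bound: "cmod (prim x k l) \<le> \<bar>x\<bar>" for x k l
      using norm_prim_diff[of x k l 0] by simp
    have "((\<lambda>l. of_real (inverse (s - t)) * (prim s k l * (a (k + l) * cnj (b l)) + - (prim t k l * (a (k + l) * cnj (b l)))))
        has_sum (of_real (inverse (s - t)) * (bilin (prim s) a b k + - bilin (prim t) a b k))) UNIV"
      by (intro has_sum_cmult_right has_sum_add has_sum_uminusI bilin_has_sum[OF bound a b])
    then have "((\<lambda>l. q l s * c l) has_sum inverse (s - t) *\<^sub>R (bilin (prim s) a b k - bilin (prim t) a b k)) UNIV"
      using that by (simp add: q_def c_def scaleR_conv_of_real algebra_simps)
    then show ?thesis by (rule infsumI)
  qed
  have "\<forall>\<^sub>F s in at t. (\<Sum>\<^sub>\<infinity>l. q l s * c l) = inverse (s - t) *\<^sub>R (bilin (prim s) a b k - bilin (prim t) a b k)"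
    by (simp add: quot eventually_at_filter)
  with lim[unfolded at_t] have "((\<lambda>s. inverse (s - t) *\<^sub>R (bilin (prim s) a b k - bilin (prim t) a b k)) \<longlongrightarrow> bilin (osc t) a b k) (at t)"
    by (rule Lim_transform_eventually)
  then show ?thesis
    by (rule has_vector_derivative_at_within[OF has_vector_derivative_iff_quotient[THEN iffD2]])
qed

section \<open>Differential inequalities in weighted sequence spaces\<close>

text \<open>Testing \<open>D\<close> against its own increment, restricted to finitely many frequencies, reduces the
  claim to the scalar mean value inequality.\<close>

lemma hbound_mean_value:
  assumes "a \<le> b"
    and der: "\<And>s k. s \<in> {a..b} \<Longrightarrow> ((\<lambda>s. D s k) has_vector_derivative D' s k) (at s within {a..b})"
    and bound: "\<And>s. s \<in> {a..b} \<Longrightarrow> hbound r (D' s) (\<phi>' s)"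
    and phi: "\<And>s. s \<in> {a..b} \<Longrightarrow> (\<phi> has_vector_derivative \<phi>' s) (at s within {a..b})"
  shows "hbound r (\<lambda>k. D b k - D a k) (\<phi> b - \<phi> a)"
proof (cases "a = b")
  case True
  then show ?thesis by simp
next
  case False
  with assms have ab: "a < b" by simp
  show ?thesis
    unfolding hbound_def
  proof (intro allI impI)
    fix S :: "int set" assume S: "finite S"
    define c where "c = (\<lambda>k. D b k - D a k)"
    define X where "X = L2_set (\<lambda>k. weight r k * cmod (c k)) S"
    define f where "f = (\<lambda>s. \<Sum>k\<in>S. of_real ((weight r k)\<^sup>2) * cnj (c k) * D s k)"
    define f' where "f' = (\<lambda>s. \<Sum>k\<in>S. of_real ((weight r k)\<^sup>2) * cnj (c k) * D' s k)"
    have f_der: "(f has_vector_derivative f' s) (at s within {a..b})" if "s \<in> {a..b}" for s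
      unfolding f_def f'_def
      by (intro has_vector_derivative_sum has_vector_derivative_mult_right der that)
    have X_nonneg: "X \<ge> 0" by (simp add: X_def)
    have "norm (f b - f a) \<le> X * \<phi> b - X * \<phi> a"
    proof (rule differentiable_bound_general[OF ab])
      show "continuous_on {a..b} f"
        by (rule continuous_on_vector_derivative) (rule f_der)
      show "continuous_on {a..b} (\<lambda>s. X * \<phi> s)"
        by (intro continuous_intros continuous_on_vector_derivative) (rule phi)
      fix s assume s: "a < s" "s < b"
      then have at: "at s within {a..b} = at s" by (simp add: at_within_Icc_at)
      show "(f has_vector_derivative f' s) (at s)"
        using f_der[of s] s by (simp add: at)
      show "((\<lambda>s. X * \<phi> s) has_vector_derivative X * \<phi>' s) (at s)"
        using phi[of s] s by (intro has_vector_derivative_mult_right) (simp add: at)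
      have "norm (f' s) \<le> (\<Sum>k\<in>S. \<bar>weight r k * cmod (c k)\<bar> * \<bar>weight r k * cmod (D' s k)\<bar>)"
        unfolding f'_def
        by (rule order_trans[OF norm_sum])
          (auto simp: norm_mult abs_mult power2_eq_square mult_ac intro!: sum_mono)
      also have "\<dots> \<le> X * L2_set (\<lambda>k. weight r k * cmod (D' s k)) S"
        unfolding X_def by (rule L2_set_mult_ineq)
      also have "\<dots> \<le> X * \<phi>' s"
        by (intro mult_left_mono hboundD[OF bound] X_nonneg S) (use s in auto)
      finally show "norm (f' s) \<le> X * \<phi>' s" .
    qed
    also have "f b - f a = of_real (X\<^sup>2)"
    proof -
      have "X\<^sup>2 = (\<Sum>k\<in>S. (weight r k)\<^sup>2 * (cmod (c k))\<^sup>2)"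
        by (simp add: X_def L2_set_def sum_nonneg power_mult_distrib)
      moreover have "f b - f a = (\<Sum>k\<in>S. of_real ((weight r k)\<^sup>2) * (cnj (c k) * c k))"
        by (simp add: f_def c_def algebra_simps flip: sum_subtractf)
      moreover have "cnj (c k) * c k = of_real ((cmod (c k))\<^sup>2)" for k
        by (simp only: complex_norm_square mult.commute)
      ultimately show ?thesis by simp
    qed
    finally have "X * X \<le> X * (\<phi> b - \<phi> a)"
      using X_nonneg by (simp add: power2_eq_square right_diff_distrib norm_mult)
    \<comment> \<open>Needed when \<open>X = 0\<close>, where the inequality above cannot be divided
      by \<open>X\<close>.\<close>
    moreover have "0 \<le> \<phi> b - \<phi> a"
    proof -
      have "norm ((\<lambda>_. 0 :: real) b - (\<lambda>_. 0) a) \<le> \<phi> b - \<phi> a"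
      proof (rule differentiable_bound_general[OF ab, where f' = "\<lambda>_. 0" and \<phi>' = \<phi>'])
        show "continuous_on {a..b} \<phi>"
          by (rule continuous_on_vector_derivative) (rule phi)
        fix s assume s: "a < s" "s < b"
        then show "(\<phi> has_vector_derivative \<phi>' s) (at s)"
          using phi[of s] by (simp add: at_within_Icc_at)
        show "norm (0::real) \<le> \<phi>' s"
          using hbound_nonneg[OF bound[of s]] s by simp
      qed (simp_all add: has_vector_derivative_const)
      then show ?thesis by simp
    qed
    ultimately have "X \<le> \<phi> b - \<phi> a"
      using X_nonneg by (cases "X = 0") (auto simp: mult_le_cancel_left_pos)
    then show "L2_set (\<lambda>k. weight r k * cmod (D b k - D a k)) S \<le> \<phi> b - \<phi> a"
      by (simp add: X_def c_def)
  qed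
qed

text \<open>Each application of the mean value inequality halves the excess of the constant over \<open>2 d\<close>.\<close>

lemma hbound_gronwall:
  assumes der: "\<And>s k. s \<in> {0..\<tau>} \<Longrightarrow> ((\<lambda>s. D s k) has_vector_derivative D' s k) (at s within {0..\<tau>})"
    and L: "L \<ge> 0" and lin: "\<And>s K. s \<in> {0..\<tau>} \<Longrightarrow> hbound r (D s) K \<Longrightarrow> hbound r (D' s) (L * K)"
    and crude: "\<And>s. s \<in> {0..\<tau>} \<Longrightarrow> hbound r (D s) B"
    and init: "hbound r (D 0) d" and t: "t \<in> {0..\<tau>}"
  shows "hbound r (D t) (2 * d * exp (2 * L * t))"
proof -
  have d: "d \<ge> 0" using hbound_nonneg[OF init] .
  have B: "B \<ge> 0" using hbound_nonneg[OF crude[OF t]] .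
  have iter: "\<forall>t\<in>{0..\<tau>}. hbound r (D t) ((2 * d + B / 2 ^ n) * exp (2 * L * t))" for n
  proof (induction n)
    \<comment> \<open>The crude bound \<open>B\<close> starts the iteration; its contribution tends
      to 0.\<close>
    case 0
    show ?case
    proof
      fix t assume t: "t \<in> {0..\<tau>}"
      have "B * 1 \<le> (2 * d + B) * exp (2 * L * t)"
        using t L d B by (intro mult_mono) auto
      with hbound_mono[OF crude[OF t]] show "hbound r (D t) ((2 * d + B / 2 ^ 0) * exp (2 * L * t))"
        by simp
    qed
  next
    case (Suc n)
    define K where "K = 2 * d + B / 2 ^ n"
    have K: "K \<ge> 0" using d B by (simp add: K_def)
    show ?case
    proof
      fix t assume t: "t \<in> {0..\<tau>}"
      \<comment> \<open>The rate \<open>2 * L\<close> instead of \<open>L\<close> is the source of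
        the halving: the integral of \<open>L * K * exp (2 * L * s)\<close> is
        \<open>K / 2 * exp (2 * L * t) - K / 2\<close>.\<close>
      have "hbound r (\<lambda>k. D t k - D 0 k) (K / 2 * exp (2 * L * t) - K / 2 * exp (2 * L * 0))"
      proof (rule hbound_mean_value)
        show "0 \<le> t" using t by simp
        fix s assume s: "s \<in> {0..t}"
        show "((\<lambda>s. D s k) has_vector_derivative D' s k) (at s within {0..t})" for k
          by (rule has_vector_derivative_within_subset[OF der]) (use s t in auto)
        show "hbound r (D' s) (L * (K * exp (2 * L * s)))"
          by (rule lin) (use s t Suc.IH in \<open>auto simp: K_def\<close>)
        show "((\<lambda>s. K / 2 * exp (2 * L * s)) has_vector_derivative L * (K * exp (2 * L * s))) (at s within {0..t})"
          unfolding has_real_derivative_iff_has_vector_derivative[symmetric]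
          by (auto intro!: derivative_eq_intros)
      qed
      from hbound_add[OF this init]
      have "hbound r (D t) (K / 2 * exp (2 * L * t) - K / 2 + d)" by simp
      then show "hbound r (D t) ((2 * d + B / 2 ^ Suc n) * exp (2 * L * t))"
      proof (rule hbound_mono)
        have "d * 1 \<le> d * exp (2 * L * t)" using d L t by (intro mult_left_mono) auto
        then show "K / 2 * exp (2 * L * t) - K / 2 + d \<le> (2 * d + B / 2 ^ Suc n) * exp (2 * L * t)"
          using K B by (simp add: K_def add_divide_distrib distrib_right)
      qed
    qed
  qed
  have "(\<lambda>n. (2 * d + B / 2 ^ n) * exp (2 * L * t)) \<longlonglongrightarrow> (2 * d + 0) * exp (2 * L * t)"
    by (intro tendsto_intros LIMSEQ_divide_realpow_zero) auto
  show ?thesis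
  proof (rule hbound_le_epsilon)
    fix e :: real assume "e > 0"
    then have "\<forall>\<^sub>F n in sequentially. (2 * d + B / 2 ^ n) * exp (2 * L * t) < 2 * d * exp (2 * L * t) + e"
      using order_tendstoD(2)[OF \<open>_ \<longlonglongrightarrow> _\<close>, of "2 * d * exp (2 * L * t) + e"] by simp
    then obtain n where "(2 * d + B / 2 ^ n) * exp (2 * L * t) < 2 * d * exp (2 * L * t) + e"
      using eventually_sequentially by auto
    then show "hbound r (D t) (2 * d * exp (2 * L * t) + e)"
      using iter[of n] t hbound_mono less_imp_le by blast
  qed
qed

section \<open>Solutions in the interaction picture\<close>

text \<open>\<open>A t k\<close> stands for \<open>exp (i t k\<^sup>2)\<close> times the \<open>k\<close>-th Fourier coefficient of a solution. The
  resonance function \<open>k\<^sup>2 - (k + l)\<^sup>2 + l\<^sup>2 = - 2 k l\<close> gives the phase in \<^const>\<open>osc\<close>.\<close>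

definition profile ::
  "complex \<Rightarrow> real \<Rightarrow> real \<Rightarrow> (int \<Rightarrow> complex) \<Rightarrow> (real \<Rightarrow> int \<Rightarrow> complex) \<Rightarrow> bool" where
  "profile \<mu> r \<tau> a A \<longleftrightarrow> A 0 = a \<and> (\<exists>B. \<forall>t\<in>{0..\<tau>}. hbound r (A t) B) \<and>
     (\<forall>t\<in>{0..\<tau>}. \<forall>k. ((\<lambda>s. A s k) has_vector_derivative
        (- \<i> * \<mu> * bilin (osc t) (A t) (A t) k)) (at t within {0..\<tau>}))"

lemma profile_init: "profile \<mu> r \<tau> a A \<Longrightarrow> A 0 = a"
  by (simp add: profile_def)

lemma profile_derivative:
  assumes "profile \<mu> r \<tau> a A" "t \<in> S" "S \<subseteq> {0..\<tau>}"
  shows "((\<lambda>s. A s k) has_vector_derivative (- \<i> * \<mu> * bilin (osc t) (A t) (A t) k)) (at t within S)"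
  by (rule has_vector_derivative_within_subset[OF _ assms(3)]) (use assms in \<open>auto simp: profile_def\<close>)

lemma profile_restrict:
  assumes "profile \<mu> r T a A" "\<tau> \<le> T"
  shows "profile \<mu> r \<tau> a A"
proof -
  obtain B where "\<forall>t\<in>{0..T}. hbound r (A t) B" using assms by (auto simp: profile_def)
  then show ?thesis
    using assms profile_init[OF assms(1)] profile_derivative[OF assms(1), of _ "{0..\<tau>}"]
    by (auto simp: profile_def intro!: exI[of _ B])
qed

lemma profile_weaken:
  assumes "profile \<mu> r \<tau> a A" "s \<le> r"
  shows "profile \<mu> s \<tau> a A"
  using assms hbound_weaken unfolding profile_def by blast

definition nonlin_const :: "complex \<Rightarrow> real \<Rightarrow> real" where
  "nonlin_const \<mu> r = cmod \<mu> * bilin_const r"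

lemma nonlin_const_nonneg: "nonlin_const \<mu> r \<ge> 0"
  by (simp add: nonlin_const_def bilin_const_nonneg)

lemma nonlin_bound:
  assumes "r > 1/2" "hbound r a A" "hbound r b B"
  shows "hbound r (\<lambda>k. - \<i> * \<mu> * bilin (osc t) a b k) (nonlin_const \<mu> r * A * B)"
  using hbound_cmult[OF bilin_bound[OF assms(1) _ assms(2,3), of "osc t" 1], of "- \<i> * \<mu>"]
  by (simp add: nonlin_const_def norm_mult mult.assoc)

lemma profile_diff_derivative:
  assumes r: "r > 1/2" and W: "profile \<mu> r \<tau> w W" and V: "profile \<mu> r \<tau> v V" and t: "t \<in> {0..\<tau>}"
  shows "((\<lambda>s. W s k - V s k) has_vector_derivative
      (- \<i> * \<mu> * bilin (osc t) (\<lambda>k. W t k - V t k) (W t) k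
       + - \<i> * \<mu> * bilin (osc t) (V t) (\<lambda>k. W t k - V t k) k)) (at t within {0..\<tau>})"
proof -
  obtain BW BV where "hbound r (W t) BW" "hbound r (V t) BV"
    using W V t unfolding profile_def by blast
  then have *: "bilin (osc t) (W t) (W t) k - bilin (osc t) (V t) (V t) k
      = bilin (osc t) (\<lambda>k. W t k - V t k) (W t) k + bilin (osc t) (V t) (\<lambda>k. W t k - V t k) k"
    by (intro bilin_diff_hbound[OF r, of _ 1]) auto
  have "((\<lambda>s. W s k - V s k) has_vector_derivative
      (- \<i> * \<mu> * bilin (osc t) (W t) (W t) k - - \<i> * \<mu> * bilin (osc t) (V t) (V t) k)) (at t within {0..\<tau>})"
    by (intro has_vector_derivative_diff profile_derivative[OF W] profile_derivative[OF V] t order_refl)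
  moreover have "- \<i> * \<mu> * bilin (osc t) (W t) (W t) k - - \<i> * \<mu> * bilin (osc t) (V t) (V t) k
      = - \<i> * \<mu> * bilin (osc t) (\<lambda>k. W t k - V t k) (W t) k
       + - \<i> * \<mu> * bilin (osc t) (V t) (\<lambda>k. W t k - V t k) k"
    using arg_cong[OF *, of "\<lambda>z. - \<i> * \<mu> * z"] by (simp only: ring_distribs)
  ultimately show ?thesis by simp
qed

text \<open>The equation for \<open>W - V\<close> is linear in \<open>W - V\<close>, with
  coefficients controlled by \<open>MW\<close> and \<open>MV\<close>, so Gronwall applies. The case
  \<open>d = 0\<close> is uniqueness.\<close>

lemma profile_diff_bound:
  assumes r: "r > 1/2" and W: "profile \<mu> r \<tau> w W" and V: "profile \<mu> r \<tau> v V"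
    and MW: "\<And>t. t \<in> {0..\<tau>} \<Longrightarrow> hbound r (W t) MW" and MV: "\<And>t. t \<in> {0..\<tau>} \<Longrightarrow> hbound r (V t) MV"
    and d: "hbound r (\<lambda>k. w k - v k) d" and t: "t \<in> {0..\<tau>}"
  shows "hbound r (\<lambda>k. W t k - V t k) (2 * d * exp (2 * (nonlin_const \<mu> r * (MW + MV)) * t))"
proof (rule hbound_gronwall[where \<tau> = \<tau>, OF profile_diff_derivative[OF r W V]])
  have "MW \<ge> 0" "MV \<ge> 0" using hbound_nonneg[OF MW[OF t]] hbound_nonneg[OF MV[OF t]] by auto
  then show "0 \<le> nonlin_const \<mu> r * (MW + MV)"
    by (simp add: nonlin_const_nonneg)
  fix s assume s: "s \<in> {0..\<tau>}"
  show "hbound r (\<lambda>k. W s k - V s k) (MW + MV)"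
    by (rule hbound_minus[OF MW[OF s] MV[OF s]])
  fix K assume "hbound r (\<lambda>k. W s k - V s k) K"
  from hbound_add[OF nonlin_bound[OF r this MW[OF s], of \<mu> s] nonlin_bound[OF r MV[OF s] this, of \<mu> s]]
  show "hbound r (\<lambda>k. - \<i> * \<mu> * bilin (osc s) (\<lambda>k. W s k - V s k) (W s) k
         + - \<i> * \<mu> * bilin (osc s) (V s) (\<lambda>k. W s k - V s k) k) (nonlin_const \<mu> r * (MW + MV) * K)"
    by (simp add: algebra_simps)
qed (use t d profile_init[OF W] profile_init[OF V] in auto)

lemma profile_lipschitz:
  assumes r: "r > 1/2" and A: "profile \<mu> r \<tau> a A"
    and M: "\<And>t. t \<in> {0..\<tau>} \<Longrightarrow> hbound r (A t) M" and st: "0 \<le> s" "s \<le> t" "t \<le> \<tau>"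
  shows "hbound r (\<lambda>k. A t k - A s k) (nonlin_const \<mu> r * M * M * (t - s))"
proof -
  have "hbound r (\<lambda>k. A t k - A s k) (nonlin_const \<mu> r * M * M * t - nonlin_const \<mu> r * M * M * s)"
  proof (rule hbound_mean_value[OF st(2)])
    fix x assume "x \<in> {s..t}"
    then show "((\<lambda>x. A x k) has_vector_derivative (- \<i> * \<mu> * bilin (osc x) (A x) (A x) k)) (at x within {s..t})" for k
      by (rule profile_derivative[OF A]) (use st in auto)
    show "hbound r (\<lambda>k. - \<i> * \<mu> * bilin (osc x) (A x) (A x) k) (nonlin_const \<mu> r * M * M)"
      by (intro nonlin_bound r M) (use st \<open>x \<in> _\<close> in auto)
    show "((\<lambda>s. nonlin_const \<mu> r * M * M * s) has_vector_derivative nonlin_const \<mu> r * M * M) (at x within {s..t})"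
      unfolding has_real_derivative_iff_has_vector_derivative[symmetric]
      by (auto intro!: derivative_eq_intros)
  qed
  then show ?thesis by (simp add: right_diff_distrib)
qed

section \<open>Uniform bounds\<close>

text \<open>A continuity argument in discrete time steps. A difference of at most 1/2 can grow to at
  most 1 within one step; this rough bound controls \<open>W\<close> by \<open>M + 1\<close>, and
  \<open>profile_diff_bound\<close> together with \<open>small\<close> improves the difference to
  1/2 again. The final bound depends on \<open>M\<close> alone, although the bound contained in
  \<open>profile\<close> for \<open>W\<close> is unrelated to \<open>M\<close>.\<close>

lemma profile_stability:
  assumes r: "r > 1/2" and W: "profile \<mu> r \<tau> w W" and V: "profile \<mu> r \<tau> v V"
    and M: "\<And>t. t \<in> {0..\<tau>} \<Longrightarrow> hbound r (V t) M"
    and d: "hbound r (\<lambda>k. w k - v k) d"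
    and small: "2 * d * exp (2 * (nonlin_const \<mu> r * (2 * M + 1)) * \<tau>) \<le> 1/2"
    and t: "t \<in> {0..\<tau>}"
  shows "hbound r (W t) (M + 1)"
proof -
  obtain B where B: "\<And>t. t \<in> {0..\<tau>} \<Longrightarrow> hbound r (W t) B"
    using W unfolding profile_def by blast
  \<comment> \<open>A Lipschitz constant in time for \<open>W - V\<close>; the summand 1 makes it
    positive, so that the step length \<open>\<delta>\<close> below makes sense. Through
    \<open>B\<close> it influences the number of steps, but not the estimate obtained.\<close>
  define \<Lambda> where "\<Lambda> = nonlin_const \<mu> r * B * B + nonlin_const \<mu> r * M * M + 1"
  have M0: "M \<ge> 0" using hbound_nonneg[OF M[OF t]] .
  have d0: "d \<ge> 0" using hbound_nonneg[OF d] .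
  have \<Lambda>: "\<Lambda> > 0" using nonlin_const_nonneg[of \<mu> r] unfolding \<Lambda>_def
    by (smt (verit, ccfv_SIG) mult.assoc mult_nonneg_nonneg zero_le_square)
  have lip: "hbound r (\<lambda>k. (W t k - V t k) - (W s k - V s k)) (\<Lambda> * (t - s))" if "0 \<le> s" "s \<le> t" "t \<le> \<tau>" for s t
  proof -
    have "hbound r (\<lambda>k. (W t k - W s k) - (V t k - V s k))
        (nonlin_const \<mu> r * B * B * (t - s) + nonlin_const \<mu> r * M * M * (t - s))"
      by (intro hbound_minus profile_lipschitz[OF r W] profile_lipschitz[OF r V] B M that)
    from hbound_mono[OF this, of "\<Lambda> * (t - s)"] show ?thesis
      using that by (simp add: \<Lambda>_def algebra_simps)
  qed
  define \<delta> where "\<delta> = 1 / (2 * \<Lambda>)"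
  have \<delta>: "\<delta> > 0" "\<Lambda> * \<delta> = 1/2" using \<Lambda> by (auto simp: \<delta>_def)
  have bootstrap: "\<forall>t\<in>{0..\<tau>}. t \<le> real n * \<delta> \<longrightarrow> hbound r (\<lambda>k. W t k - V t k) (1/2)" for n
  proof (induction n)
    case 0
    have "2 * d * 1 \<le> 2 * d * exp (2 * (nonlin_const \<mu> r * (2 * M + 1)) * \<tau>)"
      using d0 M0 t nonlin_const_nonneg[of \<mu> r] by (intro mult_left_mono) auto
    then have "hbound r (\<lambda>k. w k - v k) (1/2)"
      using small by (intro hbound_mono[OF d]) (use d0 in auto)
    then show ?case
      using profile_init[OF W] profile_init[OF V] by auto
  next
    case (Suc n)
    show ?case
    proof (intro ballI impI)
      fix t assume t: "t \<in> {0..\<tau>}" "t \<le> real (Suc n) * \<delta>"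
      \<comment> \<open>Going back by at most \<open>\<delta>\<close> reaches a time covered by the
        induction hypothesis, and the difference changes by at most
        \<open>\<Lambda> * \<delta> = 1/2\<close> on the way.\<close>
      have one: "hbound r (\<lambda>k. W s k - V s k) 1" if s: "s \<in> {0..t}" for s
      proof -
        define s' where "s' = max 0 (s - \<delta>)"
        have s': "0 \<le> s'" "s' \<le> s" "s' \<le> real n * \<delta>" "s - s' \<le> \<delta>"
          using s t \<delta> by (auto simp: s'_def algebra_simps max_def)
        then have "hbound r (\<lambda>k. W s' k - V s' k) (1/2)"
          using Suc.IH s t by auto
        moreover have "hbound r (\<lambda>k. (W s k - V s k) - (W s' k - V s' k)) (1/2)"
        proof (rule hbound_mono[OF lip])
          show "\<Lambda> * (s - s') \<le> 1/2"
            using mult_left_mono[OF s'(4), of \<Lambda>] \<Lambda> \<delta>(2) by linarith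
        qed (use s' s t in auto)
        ultimately show ?thesis
          using hbound_add by fastforce
      qed
      \<comment> \<open>The bounds \<open>M + 1\<close> for \<open>W\<close> and \<open>M\<close>
        for \<open>V\<close> explain the \<open>2 * M + 1\<close> in \<open>small\<close>.\<close>
      have "hbound r (W s) (M + 1)" if "s \<in> {0..t}" for s
        using hbound_add[OF one[OF that] M[of s]] that t by (simp add: add.commute)
      then have "hbound r (\<lambda>k. W t k - V t k) (2 * d * exp (2 * (nonlin_const \<mu> r * (M + 1 + M)) * t))"
        using t by (intro profile_diff_bound[OF r profile_restrict[OF W] profile_restrict[OF V] _ _ d, where \<tau> = t] M) auto
      moreover have "2 * d * exp (2 * (nonlin_const \<mu> r * (M + 1 + M)) * t)
          \<le> 2 * d * exp (2 * (nonlin_const \<mu> r * (2 * M + 1)) * \<tau>)"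
        using d0 t M0 nonlin_const_nonneg[of \<mu> r] by (intro mult_left_mono) (auto intro!: mult_mono)
      ultimately show "hbound r (\<lambda>k. W t k - V t k) (1/2)"
        using small by (meson hbound_mono order_trans)
    qed
  qed
  obtain n where "\<tau> / \<delta> \<le> real n" using real_arch_simple by blast
  then have "t \<le> real n * \<delta>" using t pos_divide_le_eq[OF \<delta>(1), of \<tau> "real n"] by simp
  then have "hbound r (\<lambda>k. W t k - V t k) (1/2)"
    using bootstrap[of n] t by blast
  then have "hbound r (\<lambda>k. W t k - V t k) 1"
    by (rule hbound_mono) simp
  from hbound_add[OF this M[OF t]] show ?thesis by (simp add: add.commute)
qed

text \<open>By the tame estimate the h^r norm enters the nonlinearity only linearly, with a
  coefficient controlled by the h^s norm. Gronwall is therefore linear and no smallness or short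
  time is required.\<close>

lemma profile_persistence:
  assumes s: "1/2 < s" "s \<le> r" and A: "profile \<mu> r \<tau> a A"
    and M: "\<And>t. t \<in> {0..\<tau>} \<Longrightarrow> hbound s (A t) M"
    and a: "hbound r a R" and t: "t \<in> {0..\<tau>}"
  shows "hbound r (A t) (2 * R * exp (2 * (cmod \<mu> * 4 powr (r / 2) * 2 * embed_const s * M) * t))"
proof -
  obtain B where B: "\<And>t. t \<in> {0..\<tau>} \<Longrightarrow> hbound r (A t) B"
    using A unfolding profile_def by blast
  show ?thesis
  proof (rule hbound_gronwall[where \<tau> = \<tau>, OF profile_derivative[OF A]])
    show "0 \<le> cmod \<mu> * 4 powr (r / 2) * 2 * embed_const s * M"
      using hbound_nonneg[OF M[OF t]] by (simp add: embed_const_nonneg)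
    fix x K assume x: "x \<in> {0..\<tau>}" and K: "hbound r (A x) K"
    note l1 = hbound_imp_l1bound[OF s(1) M[OF x]]
    have "hbound r (bilin (osc x) (A x) (A x)) (1 * 4 powr (r / 2) * (K * (embed_const s * M) + embed_const s * M * K))"
      by (rule bilin_hbound[OF _ _ K l1 K l1]) (use s in auto)
    from hbound_cmult[OF this, of "- \<i> * \<mu>"]
    show "hbound r (\<lambda>k. - \<i> * \<mu> * bilin (osc x) (A x) (A x) k)
        (cmod \<mu> * 4 powr (r / 2) * 2 * embed_const s * M * K)"
      by (simp add: norm_mult algebra_simps)
  qed (use t a B profile_init[OF A] in auto)
qed

text \<open>The topology is the product topology on \<open>int \<Rightarrow> complex\<close>, that
  is, coordinatewise convergence. Tychonoff applies to the product of discs containing the ball, and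
  the ball is closed because each finite section of the norm is continuous. The passage to the h^s
  norm is the next lemma.\<close>

lemma compact_hbound: "compact {a. hbound r a R}"
proof -
  define S where "S = (\<lambda>k. cball (0::complex) (R / weight r k))"
  have "compactin (product_topology (\<lambda>_. euclidean) UNIV) (PiE UNIV S)"
    by (auto simp: compactin_PiE S_def)
  then have "compact (PiE UNIV S)"
    by (simp add: euclidean_product_topology)
  moreover have "closed {a. hbound r a R}"
    unfolding hbound_def L2_set_def
    by (intro closed_Collect_all closed_Collect_imp closed_Collect_le open_Collect_const continuous_intros)
      (auto intro!: continuous_intros)
  ultimately have "compact (PiE UNIV S \<inter> {a. hbound r a R})"
    by (rule compact_Int_closed)
  also have "PiE UNIV S \<inter> {a. hbound r a R} = {a. hbound r a R}"
  proof -
    have "cmod (a k) \<le> R / weight r k" if "hbound r a R" for a k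
      using hbound_coeff[OF that, of k] weight_pos[of r k] by (simp add: field_simps)
    then show ?thesis by (auto simp: S_def)
  qed
  finally show ?thesis .
qed

text \<open>Inside an h^r ball frequencies beyond \<open>N\<close> gain a factor that tends to 0 as
  \<open>N\<close> grows, because s < r. Hence finitely many coordinates control the h^s distance,
  and a neighbourhood in the product topology serves as one in h^s.\<close>

lemma hbound_tail_small:
  assumes "s < r" "e > 0"
  shows "\<exists>N \<delta>. \<delta> > 0 \<and> (\<forall>a b. hbound r a R \<longrightarrow> hbound r b R \<longrightarrow>
           (\<forall>k\<in>{- int N..int N}. cmod (a k - b k) < \<delta>) \<longrightarrow> hbound s (\<lambda>k. a k - b k) e)"
proof -
  have "filterlim (\<lambda>n. 1 + (real n)\<^sup>2) at_top sequentially"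
  proof (rule filterlim_at_top_mono[OF filterlim_real_sequentially], intro always_eventually allI)
    show "real n \<le> 1 + (real n)\<^sup>2" for n
      using sum_squares_bound[of "real n" 1] by simp
  qed
  \<comment> \<open>The absolute value is taken because \<open>R\<close> is known to be nonnegative
    only once some sequence satisfies \<open>hbound r a R\<close>.\<close>
  then have "(\<lambda>n. (1 + (real n)\<^sup>2) powr ((s - r) / 2) * (2 * \<bar>R\<bar>)) \<longlonglongrightarrow> 0 * (2 * \<bar>R\<bar>)"
    using assms by (intro tendsto_mult tendsto_neg_powr tendsto_const) auto
  then have "\<forall>\<^sub>F n in sequentially. (1 + (real n)\<^sup>2) powr ((s - r) / 2) * (2 * \<bar>R\<bar>) < e / 2"
    using assms by (intro order_tendstoD) auto
  then obtain N where N: "(1 + (real N)\<^sup>2) powr ((s - r) / 2) * (2 * \<bar>R\<bar>) < e / 2"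
    using eventually_sequentially by auto
  define \<eta> where "\<eta> = (1 + (real N)\<^sup>2) powr ((s - r) / 2)"
  define J where "J = {- int N..int N}"
  define w where "w = (\<Sum>k\<in>J. weight s k) + 1"
  have w: "w > 0" unfolding w_def by (simp add: add_nonneg_pos sum_nonneg)
  \<comment> \<open>On the low frequencies the l^2 norm is bounded by the l^1 norm, hence by
    \<open>w * \<delta> = e / 2\<close>; the other half of \<open>e\<close> is left for the
    tail.\<close>
  define \<delta> where "\<delta> = e / (2 * w)"
  have \<delta>: "\<delta> > 0" using assms w by (simp add: \<delta>_def)
  have high: "weight s k \<le> \<eta> * weight r k" if "k \<notin> J" for k
  proof -
    have "(real N)\<^sup>2 \<le> (real_of_int k)\<^sup>2"
    proof -
      have "real N \<le> \<bar>real_of_int k\<bar>" using that by (auto simp: J_def)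
      from power_mono[OF this, of 2] show ?thesis by simp
    qed
    then have "(1 + (of_int k)\<^sup>2) powr ((s - r) / 2) \<le> \<eta>"
      unfolding \<eta>_def using assms by (intro powr_mono2') (auto intro: add_pos_nonneg)
    then have "(1 + (of_int k)\<^sup>2) powr ((s - r) / 2) * weight r k \<le> \<eta> * weight r k"
      by (intro mult_right_mono) auto
    then show ?thesis
      by (simp add: weight_def diff_divide_distrib flip: powr_add)
  qed
  have "hbound s (\<lambda>k. a k - b k) e"
    if a: "hbound r a R" and b: "hbound r b R" and close: "\<forall>k\<in>J. cmod (a k - b k) < \<delta>" for a b
  proof -
    define c where "c = (\<lambda>k. a k - b k)"
    have R: "R \<ge> 0" using hbound_nonneg[OF a] .
    have c: "hbound r c (2 * R)" using hbound_minus[OF a b] by (simp add: c_def)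
    have "hbound s (\<lambda>k. if k \<in> J then c k else 0) (e / 2)"
      unfolding hbound_def
    proof (intro allI impI)
      fix S :: "int set" assume S: "finite S"
      have "L2_set (\<lambda>k. weight s k * cmod (if k \<in> J then c k else 0)) S
          \<le> (\<Sum>k\<in>S. \<bar>weight s k * cmod (if k \<in> J then c k else 0)\<bar>)"
        by (rule L2_set_le_sum_abs)
      also have "\<dots> = (\<Sum>k\<in>S \<inter> J. weight s k * cmod (c k))"
        by (intro sum.mono_neutral_cong_right S) auto
      also have "\<dots> \<le> (\<Sum>k\<in>S \<inter> J. weight s k * \<delta>)"
        using close by (intro sum_mono mult_left_mono) (auto simp: c_def intro: less_imp_le)
      also have "\<dots> \<le> (\<Sum>k\<in>J. weight s k * \<delta>)"
        using \<delta> by (intro sum_mono2) (auto simp: J_def)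
      also have "\<dots> \<le> w * \<delta>"
        using \<delta> by (simp add: w_def sum_distrib_right[symmetric])
      also have "\<dots> = e / 2" using w by (simp add: \<delta>_def)
      finally show "L2_set (\<lambda>k. weight s k * cmod (if k \<in> J then c k else 0)) S \<le> e / 2" .
    qed
    moreover have "hbound s (\<lambda>k. if k \<in> J then 0 else c k) (e / 2)"
      unfolding hbound_def
    proof (intro allI impI)
      fix S :: "int set" assume S: "finite S"
      have "L2_set (\<lambda>k. weight s k * cmod (if k \<in> J then 0 else c k)) S
          \<le> L2_set (\<lambda>k. \<eta> * (weight r k * cmod (c k))) S"
        by (intro L2_set_mono) (auto simp: \<eta>_def mult.assoc[symmetric] intro!: mult_right_mono high[unfolded \<eta>_def])
      also have "\<dots> = \<eta> * L2_set (\<lambda>k. weight r k * cmod (c k)) S"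
        by (simp add: L2_set_right_distrib \<eta>_def)
      also have "\<dots> \<le> \<eta> * (2 * R)"
        by (intro mult_left_mono hboundD[OF c S]) (simp add: \<eta>_def)
      also have "\<dots> \<le> e / 2" using N R by (simp add: \<eta>_def)
      finally show "L2_set (\<lambda>k. weight s k * cmod (if k \<in> J then 0 else c k)) S \<le> e / 2" .
    qed
    ultimately have "hbound s (\<lambda>k. (if k \<in> J then c k else 0) + (if k \<in> J then 0 else c k)) (e / 2 + e / 2)"
      by (rule hbound_add)
    moreover have "(\<lambda>k. (if k \<in> J then c k else 0) + (if k \<in> J then 0 else c k)) = (\<lambda>k. a k - b k)"
      by (auto simp: c_def)
    ultimately show ?thesis by simp
  qed
  then show ?thesis using \<delta> unfolding J_def by blast
qed

text \<open>Solvability on all of \<open>{0..T}\<close> is used only for the centres of the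
  neighbourhoods that cover the ball; the conclusion concerns arbitrary profiles on shorter
  intervals, which stability compares with the restricted central one.\<close>

lemma profile_uniform_bound:
  assumes r: "r > 1/2" and T: "T \<ge> 0"
    and ex: "\<And>a. hbound r a R \<Longrightarrow> \<exists>A. profile \<mu> r T a A"
  shows "\<exists>M. \<forall>a A \<tau> t. hbound r a R \<longrightarrow> \<tau> \<le> T \<longrightarrow> profile \<mu> r \<tau> a A \<longrightarrow> t \<in> {0..\<tau>} \<longrightarrow> hbound r (A t) M"
proof -
  define s where "s = (r + 1/2) / 2"
  have s: "1/2 < s" "s < r" using r by (auto simp: s_def)
  have local_bound: "\<exists>U M. open U \<and> v \<in> U \<and> (\<forall>w W \<tau> t. w \<in> U \<longrightarrow> hbound r w R \<longrightarrow> \<tau> \<le> T \<longrightarrow>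
      profile \<mu> r \<tau> w W \<longrightarrow> t \<in> {0..\<tau>} \<longrightarrow> hbound s (W t) M) \<and> M \<ge> 0" if v: "hbound r v R" for v
  proof -
    obtain V where V: "profile \<mu> r T v V" using ex[OF v] by blast
    then obtain M where M: "\<And>t. t \<in> {0..T} \<Longrightarrow> hbound r (V t) M" unfolding profile_def by blast
    have M0: "M \<ge> 0" using hbound_nonneg[OF M, of 0] T by simp
    \<comment> \<open>Chosen so that the hypothesis \<open>small\<close> of
      \<open>profile_stability\<close> holds with equality at \<open>\<tau> = T\<close>.\<close>
    define d where "d = exp (- (2 * (nonlin_const \<mu> s * (2 * M + 1)) * T)) / 4"
    have "d > 0" by (simp add: d_def)
    from hbound_tail_small[OF s(2) this, of R] obtain N \<delta> where \<delta>: "\<delta> > 0"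
      and close: "\<And>a b. hbound r a R \<Longrightarrow> hbound r b R \<Longrightarrow>
           (\<forall>k\<in>{- int N..int N}. cmod (a k - b k) < \<delta>) \<Longrightarrow> hbound s (\<lambda>k. a k - b k) d" by blast
    define U where "U = (\<Inter>k\<in>{- int N..int N}. {w. cmod (w k - v k) < \<delta>})"
    have "open U"
      unfolding U_def by (intro open_INT finite_atLeastAtMost_int ballI open_Collect_less continuous_intros continuous_on_product_coordinates)
    moreover have "v \<in> U" using \<delta> by (simp add: U_def)
    moreover have "hbound s (W t) (M + 1)"
      if w: "w \<in> U" "hbound r w R" and \<tau>: "\<tau> \<le> T" and W: "profile \<mu> r \<tau> w W" and t: "t \<in> {0..\<tau>}" for w W \<tau> t
    proof (rule profile_stability[OF s(1) profile_weaken[OF W] profile_weaken[OF profile_restrict[OF V \<tau>]]])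
      show "hbound s (V t) M" if "t \<in> {0..\<tau>}" for t
        by (rule hbound_weaken[OF M]) (use that \<tau> s in auto)
      show "hbound s (\<lambda>k. w k - v k) d"
        by (rule close) (use w v in \<open>auto simp: U_def\<close>)
      have "exp (2 * (nonlin_const \<mu> s * (2 * M + 1)) * \<tau>) \<le> exp (2 * (nonlin_const \<mu> s * (2 * M + 1)) * T)"
        using \<tau> M0 nonlin_const_nonneg[of \<mu> s] by (auto intro!: mult_left_mono)
      then have "2 * d * exp (2 * (nonlin_const \<mu> s * (2 * M + 1)) * \<tau>)
          \<le> 2 * d * exp (2 * (nonlin_const \<mu> s * (2 * M + 1)) * T)"
        using \<open>d > 0\<close> by (intro mult_left_mono) auto
      also have "\<dots> = 1/2" by (simp add: d_def exp_minus)
      finally show "2 * d * exp (2 * (nonlin_const \<mu> s * (2 * M + 1)) * \<tau>) \<le> 1/2" .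
    qed (use t s in auto)
    moreover have "M + 1 \<ge> 0" using M0 by simp
    ultimately show ?thesis by blast
  qed
  then obtain U M where UM: "\<And>v. hbound r v R \<Longrightarrow> open (U v) \<and> v \<in> U v \<and>
      (\<forall>w W \<tau> t. w \<in> U v \<longrightarrow> hbound r w R \<longrightarrow> \<tau> \<le> T \<longrightarrow>
        profile \<mu> r \<tau> w W \<longrightarrow> t \<in> {0..\<tau>} \<longrightarrow> hbound s (W t) (M v)) \<and> M v \<ge> 0"
    by metis
  obtain C where C: "C \<subseteq> {a. hbound r a R}" "finite C" "{a. hbound r a R} \<subseteq> (\<Union>c\<in>C. U c)"
    by (rule compactE_image[OF compact_hbound[of r R], of "{a. hbound r a R}" U]) (use UM in auto)
  \<comment> \<open>The sum replaces a maximum and also makes sense for empty \<open>C\<close>; it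
    dominates each summand because \<open>M v \<ge> 0\<close> was recorded.\<close>
  define Ms where "Ms = (\<Sum>c\<in>C. M c)"
  define L where "L = cmod \<mu> * 4 powr (r / 2) * 2 * embed_const s * Ms"
  have Ms: "Ms \<ge> 0" unfolding Ms_def using UM C by (intro sum_nonneg) auto
  then have L: "L \<ge> 0" by (simp add: L_def embed_const_nonneg)
  have "hbound r (A t) (2 * R * exp (2 * L * T))"
    if a: "hbound r a R" and \<tau>: "\<tau> \<le> T" and A: "profile \<mu> r \<tau> a A" and t: "t \<in> {0..\<tau>}" for a A \<tau> t
  proof -
    obtain c where c: "c \<in> C" "a \<in> U c" using C a by blast
    have "M c \<le> Ms" unfolding Ms_def using UM C c by (intro member_le_sum) auto
    have "hbound s (A t) Ms" if "t \<in> {0..\<tau>}" for t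
    proof (rule hbound_mono[OF _ \<open>M c \<le> Ms\<close>])
      show "hbound s (A t) (M c)" using UM[of c] C(1) c a \<tau> A that by blast
    qed
    from profile_persistence[OF s(1) _ A this a t]
    have "hbound r (A t) (2 * R * exp (2 * L * t))" using s by (simp add: L_def)
    moreover have "2 * R * exp (2 * L * t) \<le> 2 * R * exp (2 * L * T)"
      using hbound_nonneg[OF a] L t \<tau> by (auto intro!: mult_left_mono)
    ultimately show ?thesis by (rule hbound_mono)
  qed
  then show ?thesis by blast
qed

section \<open>The local error\<close>

text \<open>Fine minus coarse propagator in the interaction picture, see
  \<open>propagator_error_fourier\<close>: the last two terms subtract the Duhamel integral with
  \<open>A\<close> frozen at its initial value.\<close>

definition local_error :: "complex \<Rightarrow> (int \<Rightarrow> complex) \<Rightarrow> (real \<Rightarrow> int \<Rightarrow> complex) \<Rightarrow> real \<Rightarrow> int \<Rightarrow> complex" where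
  "local_error \<mu> a A t k = A t k - a k + \<i> * \<mu> * bilin (prim t) a a k"

text \<open>Differentiating \<open>prim\<close> restores \<open>osc\<close>, so only the effect of
  freezing remains. Each of the two terms contains \<open>A t - a\<close>, which is O(t).\<close>

lemma local_error_derivative:
  assumes r: "r > 1/2" and A: "profile \<mu> r \<tau> a A" and t: "t \<in> {0..\<tau>}"
  shows "((\<lambda>s. local_error \<mu> a A s k) has_vector_derivative
      - \<i> * \<mu> * (bilin (osc t) (\<lambda>k. A t k - a k) (A t) k + bilin (osc t) a (\<lambda>k. A t k - a k) k))
      (at t within {0..\<tau>})"
proof -
  obtain B where B: "\<And>t. t \<in> {0..\<tau>} \<Longrightarrow> hbound r (A t) B"
    using A unfolding profile_def by blast
  have a: "hbound r a B" using B[of 0] t profile_init[OF A] by simp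
  note l1 = hbound_imp_l1bound[OF r a]
  have *: "bilin (osc t) (A t) (A t) k - bilin (osc t) a a k
      = bilin (osc t) (\<lambda>k. A t k - a k) (A t) k + bilin (osc t) a (\<lambda>k. A t k - a k) k"
    by (rule bilin_diff_hbound[OF r _ B[OF t] a B[OF t] a, of _ 1]) simp
  have "((\<lambda>s. local_error \<mu> a A s k) has_vector_derivative
      (- \<i> * \<mu> * bilin (osc t) (A t) (A t) k - 0) + \<i> * \<mu> * bilin (osc t) a a k) (at t within {0..\<tau>})"
    unfolding local_error_def
    by (intro has_vector_derivative_add has_vector_derivative_diff has_vector_derivative_const
        has_vector_derivative_mult_right bilin_prim_has_vector_derivative[OF l1 l1] profile_derivative[OF A t order_refl])
  moreover have "(- \<i> * \<mu> * bilin (osc t) (A t) (A t) k - 0) + \<i> * \<mu> * bilin (osc t) a a k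
      = - \<i> * \<mu> * (bilin (osc t) (A t) (A t) k - bilin (osc t) a a k)"
    by (simp add: right_diff_distrib)
  ultimately show ?thesis by (simp only: *)
qed

lemma local_error_bound:
  assumes r: "r > 1/2" and W: "profile \<mu> r \<tau> w W" and V: "profile \<mu> r \<tau> v V"
    and MW: "\<And>t. t \<in> {0..\<tau>} \<Longrightarrow> hbound r (W t) M" and MV: "\<And>t. t \<in> {0..\<tau>} \<Longrightarrow> hbound r (V t) M"
    and d: "hbound r (\<lambda>k. w k - v k) d" and \<tau>: "0 \<le> \<tau>" "\<tau> \<le> 1"
  defines "q \<equiv> nonlin_const \<mu> r"
  shows "hbound r (\<lambda>k. local_error \<mu> w W \<tau> k - local_error \<mu> v V \<tau> k)
           (q\<^sup>2 * M\<^sup>2 * (10 * exp (4 * q * M) + 1) * \<tau>\<^sup>2 * d)"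
proof -
  have q: "q \<ge> 0" by (simp add: q_def nonlin_const_nonneg)
  have M: "M \<ge> 0" using hbound_nonneg[OF MW[of 0]] \<tau> by simp
  have d0: "d \<ge> 0" using hbound_nonneg[OF d] .
  \<comment> \<open>\<open>G\<close> is a Lipschitz constant of the flow up to time 1: the exponent
    \<open>2 * (q * (M + M)) * t\<close> is at most \<open>4 * q * M\<close> for
    \<open>t \<le> 1\<close>.\<close>
  define G where "G = 2 * exp (4 * q * M)"
  have G: "G \<ge> 0" by (simp add: G_def)
  have w: "hbound r w M" and v: "hbound r v M"
    using MW[of 0] MV[of 0] \<tau> profile_init[OF W] profile_init[OF V] by auto
  have diff: "hbound r (\<lambda>k. W t k - V t k) (G * d)" if t: "t \<in> {0..\<tau>}" for t
  proof (rule hbound_mono[OF profile_diff_bound[OF r W V MW MV d t]])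
    have "q * M * t \<le> q * M * 1" using t \<tau> q M by (intro mult_left_mono) auto
    then have "2 * (q * (M + M)) * t \<le> 4 * q * M" by simp
    then have "exp (2 * (q * (M + M)) * t) \<le> exp (4 * q * M)" by simp
    then show "2 * d * exp (2 * (nonlin_const \<mu> r * (M + M)) * t) \<le> G * d"
      using d0 mult_left_mono[of "exp (2 * (q * (M + M)) * t)" "exp (4 * q * M)" "2 * d"]
      by (simp add: G_def q_def mult_ac)
  qed
  define P where "P = (\<lambda>t k. W t k - w k)"
  define Q where "Q = (\<lambda>t k. V t k - v k)"
  have P: "hbound r (P t) (q * M * M * t)" if "t \<in> {0..\<tau>}" for t
    using profile_lipschitz[OF r W MW, of 0 t] that profile_init[OF W] by (simp add: P_def q_def)
  have Q: "hbound r (Q t) (q * M * M * t)" if "t \<in> {0..\<tau>}" for t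
    using profile_lipschitz[OF r V MV, of 0 t] that profile_init[OF V] by (simp add: Q_def q_def)
  \<comment> \<open>Here smallness in \<open>t\<close> and in \<open>d\<close> occur together:
    \<open>W - V\<close> has a derivative of size O(d), so its increment from time 0 is O(t
    d).\<close>
  have PQ: "hbound r (\<lambda>k. P t k - Q t k) (2 * q * M * G * d * t)" if t: "t \<in> {0..\<tau>}" for t
  proof -
    have "hbound r (\<lambda>k. (W t k - V t k) - (W 0 k - V 0 k)) (2 * q * M * G * d * t - 2 * q * M * G * d * 0)"
    proof (rule hbound_mean_value)
      fix s assume s: "s \<in> {0..t}"
      then have s': "s \<in> {0..\<tau>}" using t by auto
      show "((\<lambda>s. W s k - V s k) has_vector_derivative
          (- \<i> * \<mu> * bilin (osc s) (\<lambda>k. W s k - V s k) (W s) k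
           + - \<i> * \<mu> * bilin (osc s) (V s) (\<lambda>k. W s k - V s k) k)) (at s within {0..t})" for k
        by (rule has_vector_derivative_within_subset[OF profile_diff_derivative[OF r W V s']]) (use t in auto)
      show "hbound r (\<lambda>k. - \<i> * \<mu> * bilin (osc s) (\<lambda>k. W s k - V s k) (W s) k
           + - \<i> * \<mu> * bilin (osc s) (V s) (\<lambda>k. W s k - V s k) k) (2 * q * M * G * d)"
        using hbound_add[OF nonlin_bound[OF r diff[OF s'] MW[OF s'], of \<mu> s]
            nonlin_bound[OF r MV[OF s'] diff[OF s'], of \<mu> s]]
        by (simp add: q_def mult_ac)
      show "((\<lambda>s. 2 * q * M * G * d * s) has_vector_derivative 2 * q * M * G * d) (at s within {0..t})"
        unfolding has_real_derivative_iff_has_vector_derivative[symmetric]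
        by (auto intro!: derivative_eq_intros)
    qed (use t in auto)
    then show ?thesis
      using profile_init[OF W] profile_init[OF V] by (simp add: P_def Q_def algebra_simps)
  qed
  \<comment> \<open>Of the four terms of \<open>E\<close> below, the two with \<open>P - Q\<close>
    contribute \<open>2 * G\<close> each, the one with \<open>Q\<close> and \<open>W - V\<close>
    contributes \<open>G\<close>, and the one with \<open>w - v\<close> and \<open>P\<close>
    contributes 1.\<close>
  define C where "C = q\<^sup>2 * M\<^sup>2 * (5 * G + 1)"
  have C: "C \<ge> 0" using G by (simp add: C_def)
  have "hbound r (\<lambda>k. (local_error \<mu> w W \<tau> k - local_error \<mu> v V \<tau> k)
      - (local_error \<mu> w W 0 k - local_error \<mu> v V 0 k)) (C * d / 2 * \<tau>\<^sup>2 - C * d / 2 * 0\<^sup>2)"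
  proof (rule hbound_mean_value[OF \<tau>(1)])
    fix t assume t: "t \<in> {0..\<tau>}"
    \<comment> \<open>The difference of the two error derivatives, expanded so that every term
      contains either \<open>P - Q\<close> or a product of a factor O(t) and a factor O(d).\<close>
    define E where "E = (\<lambda>k. - \<i> * \<mu> * bilin (osc t) (\<lambda>k. P t k - Q t k) (W t) k
        + - \<i> * \<mu> * bilin (osc t) (Q t) (\<lambda>k. W t k - V t k) k
        + (- \<i> * \<mu> * bilin (osc t) (\<lambda>k. w k - v k) (P t) k
        + - \<i> * \<mu> * bilin (osc t) v (\<lambda>k. P t k - Q t k) k))"
    have 1: "bilin (osc t) (P t) (W t) k - bilin (osc t) (Q t) (V t) k
        = bilin (osc t) (\<lambda>k. P t k - Q t k) (W t) k + bilin (osc t) (Q t) (\<lambda>k. W t k - V t k) k" for k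
      by (rule bilin_diff_hbound[OF r _ P[OF t] Q[OF t] MW[OF t] MV[OF t], of _ 1]) simp
    have 2: "bilin (osc t) w (P t) k - bilin (osc t) v (Q t) k
        = bilin (osc t) (\<lambda>k. w k - v k) (P t) k + bilin (osc t) v (\<lambda>k. P t k - Q t k) k" for k
      by (rule bilin_diff_hbound[OF r _ w v P[OF t] Q[OF t], of _ 1]) simp
    have E_eq: "- \<i> * \<mu> * (bilin (osc t) (P t) (W t) k + bilin (osc t) w (P t) k)
        - - \<i> * \<mu> * (bilin (osc t) (Q t) (V t) k + bilin (osc t) v (Q t) k) = E k" for k
    proof -
      have "E k = - \<i> * \<mu> * ((bilin (osc t) (P t) (W t) k - bilin (osc t) (Q t) (V t) k)
          + (bilin (osc t) w (P t) k - bilin (osc t) v (Q t) k))"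
        unfolding 1 2 E_def by (simp only: ring_distribs)
      then show ?thesis by (simp add: algebra_simps)
    qed
    show "((\<lambda>s. local_error \<mu> w W s k - local_error \<mu> v V s k) has_vector_derivative E k) (at t within {0..\<tau>})" for k
      using has_vector_derivative_diff[OF local_error_derivative[OF r W t, of k] local_error_derivative[OF r V t, of k]]
      unfolding E_eq[symmetric] P_def Q_def .
    have "hbound r E (q * (2 * q * M * G * d * t) * M + q * (q * M * M * t) * (G * d)
        + (q * d * (q * M * M * t) + q * M * (2 * q * M * G * d * t)))"
      unfolding E_def q_def
      by (intro hbound_add nonlin_bound[OF r] P[OF t, unfolded q_def] Q[OF t, unfolded q_def] PQ[OF t, unfolded q_def]
          MW[OF t] diff[OF t] d v)
    moreover have "q * (2 * q * M * G * d * t) * M + q * (q * M * M * t) * (G * d)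
        + (q * d * (q * M * M * t) + q * M * (2 * q * M * G * d * t)) = C * d * t"
      by (simp add: C_def power2_eq_square algebra_simps)
    ultimately show "hbound r E (C * d * t)" by simp
    show "((\<lambda>s. C * d / 2 * s\<^sup>2) has_vector_derivative C * d * t) (at t within {0..\<tau>})"
      unfolding has_real_derivative_iff_has_vector_derivative[symmetric]
      by (auto intro!: derivative_eq_intros)
  qed
  then have "hbound r (\<lambda>k. local_error \<mu> w W \<tau> k - local_error \<mu> v V \<tau> k) (C * d / 2 * \<tau>\<^sup>2)"
    using profile_init[OF W] profile_init[OF V] by (simp add: local_error_def)
  then show ?thesis
  proof (rule hbound_mono)
    have "C * d / 2 * \<tau>\<^sup>2 \<le> C * d * \<tau>\<^sup>2" using C d0 by (intro mult_right_mono) auto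
    then show "C * d / 2 * \<tau>\<^sup>2 \<le> q\<^sup>2 * M\<^sup>2 * (10 * exp (4 * q * M) + 1) * \<tau>\<^sup>2 * d"
      by (simp add: C_def G_def mult_ac)
  qed
qed

section \<open>Fourier coefficients and Fourier series\<close>

lemma finite_measure_torus: "finite_measure torus"
  by (rule finite_measure_lebesgue_on) auto

lemma measure_torus: "measure torus {0<..<2 * pi} = 2 * pi"
  by (simp add: measure_restrict_space)

lemma continuous_borel_torus:
  fixes f :: "real \<Rightarrow> complex"
  shows "continuous_on UNIV f \<Longrightarrow> f \<in> borel_measurable torus"
  by (rule continuous_imp_measurable_on_sets_lebesgue) (auto intro: continuous_on_subset)

lemma cis_borel_torus [measurable]: "(\<lambda>x. cis (c * x)) \<in> borel_measurable torus"
  by (rule continuous_borel_torus) (intro continuous_intros)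

lemma integrable_torus_bounded:
  fixes f :: "real \<Rightarrow> complex"
  assumes "f \<in> borel_measurable torus" "\<And>x. x \<in> {0<..<2*pi} \<Longrightarrow> cmod (f x) \<le> B"
  shows "integrable torus f"
  by (rule finite_measure.integrable_const_bound[OF finite_measure_torus _ assms(1), where B = B])
    (use assms(2) in \<open>auto intro!: AE_I2\<close>)

lemma integrable_torus_mult:
  fixes f :: "real \<Rightarrow> complex"
  assumes f: "integrable torus f" and g: "g \<in> borel_measurable torus"
    and B: "\<And>x. x \<in> {0<..<2*pi} \<Longrightarrow> cmod (g x) \<le> B"
  shows "integrable torus (\<lambda>x. f x * g x)"
proof (rule Bochner_Integration.integrable_bound)
  show "integrable torus (\<lambda>x. f x * of_real B)"
    using f by simp
  show "(\<lambda>x. f x * g x) \<in> borel_measurable torus"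
    using f g by (intro borel_measurable_times) auto
  have "cmod (g x) \<le> \<bar>B\<bar>" if "x \<in> {0<..<2*pi}" for x using B[OF that] by linarith
  then show "AE x in torus. norm (f x * g x) \<le> norm (f x * of_real B)"
    by (intro AE_I2) (auto simp: norm_mult intro!: mult_left_mono)
qed

lemma integrable_torus_cis:
  fixes f :: "real \<Rightarrow> complex"
  shows "integrable torus f \<Longrightarrow> integrable torus (\<lambda>x. f x * cis (c * x))"
  by (rule integrable_torus_mult[where B = 1]) auto

lemma square_integrable_measurable: "square_integrable f \<Longrightarrow> f \<in> borel_measurable torus"
  by (simp add: square_integrable_def)

lemma square_integrable_imp_integrable: "square_integrable f \<Longrightarrow> integrable torus f"
proof -
  assume f: "square_integrable f"
  show "integrable torus f"
  proof (rule Bochner_Integration.integrable_bound)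
    show "integrable torus (\<lambda>x. 1 + (cmod (f x))\<^sup>2)"
      using f finite_measure.integrable_const[OF finite_measure_torus]
      by (intro Bochner_Integration.integrable_add) (auto simp: square_integrable_def)
    have "a \<le> 1 + a\<^sup>2" for a :: real using zero_le_power2[of "a - 1"] by (simp add: power2_diff) (smt (verit) zero_le_power2)
    then show "AE x in torus. norm (f x) \<le> norm (1 + (cmod (f x))\<^sup>2)"
      by (intro AE_I2) (auto simp: abs_of_nonneg)
  qed (rule square_integrable_measurable[OF f])
qed

lemma square_integrable_bounded:
  assumes "f \<in> borel_measurable torus" "\<And>x. x \<in> {0<..<2*pi} \<Longrightarrow> cmod (f x) \<le> B"
  shows "square_integrable f"
  unfolding square_integrable_def
proof (intro conjI assms(1) finite_measure.integrable_const_bound[OF finite_measure_torus])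
  show "AE x in torus. norm ((cmod (f x))\<^sup>2) \<le> B\<^sup>2"
    using assms(2) by (intro AE_I2) (simp add: power_mono)
  show "(\<lambda>x. (cmod (f x))\<^sup>2) \<in> borel_measurable torus"
    using assms(1) by measurable
qed

lemma square_integrable_add:
  assumes f: "square_integrable f" and g: "square_integrable g"
  shows "square_integrable (\<lambda>x. f x + g x)"
  unfolding square_integrable_def
proof (rule conjI[OF _ Bochner_Integration.integrable_bound])
  note [measurable] = square_integrable_measurable[OF f] square_integrable_measurable[OF g]
  show "integrable torus (\<lambda>x. 2 * (cmod (f x))\<^sup>2 + 2 * (cmod (g x))\<^sup>2)"
    using f g by (simp add: square_integrable_def)
  show "(\<lambda>x. f x + g x) \<in> borel_measurable torus" by measurable
  show "(\<lambda>x. (cmod (f x + g x))\<^sup>2) \<in> borel_measurable torus" by measurable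
  have "(cmod (a + b))\<^sup>2 \<le> 2 * (cmod a)\<^sup>2 + 2 * (cmod b)\<^sup>2" for a b
  proof -
    have "(cmod (a + b))\<^sup>2 \<le> (cmod a + cmod b)\<^sup>2"
      by (intro power_mono norm_triangle_ineq) auto
    also have "\<dots> \<le> 2 * (cmod a)\<^sup>2 + 2 * (cmod b)\<^sup>2"
      using sum_squares_bound[of "cmod a" "cmod b"] by (simp add: power2_sum)
    finally show ?thesis .
  qed
  then show "AE x in torus. norm ((cmod (f x + g x))\<^sup>2) \<le> norm (2 * (cmod (f x))\<^sup>2 + 2 * (cmod (g x))\<^sup>2)"
    by (intro AE_I2) simp
qed

lemma square_integrable_cmult:
  assumes f: "square_integrable f"
  shows "square_integrable (\<lambda>x. c * f x)"
  using assms unfolding square_integrable_def by (auto simp: norm_mult power_mult_distrib)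

lemma square_integrable_diff:
  "square_integrable f \<Longrightarrow> square_integrable g \<Longrightarrow> square_integrable (\<lambda>x. f x - g x)"
  using square_integrable_add[of f "\<lambda>x. (-1) * g x"] square_integrable_cmult[of g "-1"] by simp

text \<open>The sign is moved so that the phase has the form \<open>c * x\<close> of the
  measurability, integrability and derivative lemmas.\<close>

lemma fourier_alt: "fourier f k = (LINT x|torus. f x * cis (- of_int k * x)) / of_real (2 * pi)"
  by (simp add: fourier_def)

lemma fourier_add:
  assumes "integrable torus f" "integrable torus g"
  shows "fourier (\<lambda>x. f x + g x) k = fourier f k + fourier g k"
  unfolding fourier_alt
  by (simp only: distrib_right Bochner_Integration.integral_add[OF integrable_torus_cis[OF assms(1)] integrable_torus_cis[OF assms(2)]] add_divide_distrib)

lemma fourier_cmult: "fourier (\<lambda>x. c * f x) k = c * fourier f k"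
  by (simp add: fourier_def mult.assoc)

lemma fourier_diff:
  assumes "integrable torus f" "integrable torus g"
  shows "fourier (\<lambda>x. f x - g x) k = fourier f k - fourier g k"
  using fourier_add[OF assms(1), of "\<lambda>x. (-1) * g x" k] fourier_cmult[of "-1" g k] assms by simp

lemma fourier_sum:
  assumes "finite L" "\<And>l. l \<in> L \<Longrightarrow> integrable torus (f l)"
  shows "fourier (\<lambda>x. \<Sum>l\<in>L. f l x) k = (\<Sum>l\<in>L. fourier (f l) k)"
  using assms by (induction L rule: finite_induct) (simp_all add: fourier_add, simp add: fourier_def)

lemma fourier_cnj: "fourier (\<lambda>x. cnj (f x)) k = cnj (fourier f (- k))"
proof -
  have "cnj (f x) * cis (- of_int k * x) = cnj (f x * cis (- of_int (- k) * x))" for x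
    by (simp add: cis_cnj)
  then show ?thesis
    by (simp only: fourier_alt Bochner_Integration.integral_cnj complex_cnj_divide complex_cnj_complex_of_real)
qed

lemma fourier_shift: "fourier (\<lambda>x. f x * cis (of_int l * x)) k = fourier f (k - l)"
  by (simp add: fourier_alt mult.assoc cis_mult algebra_simps)

lemma fourier_cong_AE:
  assumes "AE x in torus. f x = g x" "f \<in> borel_measurable torus" "g \<in> borel_measurable torus"
  shows "fourier f k = fourier g k"
  unfolding fourier_alt using assms(1)
  by (intro arg_cong[where f = "\<lambda>z. z / of_real (2 * pi)"] integral_cong_AE borel_measurable_times assms cis_borel_torus) auto

lemma norm_fourier_le:
  assumes "integrable torus f"
  shows "cmod (fourier f k) \<le> (LINT x|torus. cmod (f x)) / (2 * pi)"
proof -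
  have "cmod (LINT x|torus. f x * cis (- of_int k * x)) \<le> (LINT x|torus. cmod (f x * cis (- of_int k * x)))"
    by (rule integral_norm_bound)
  then show ?thesis by (simp add: fourier_alt norm_divide norm_mult divide_right_mono)
qed

lemma fourier_one: "fourier (\<lambda>_. 1) k = (if k = 0 then 1 else 0)"
proof (cases "k = 0")
  case True
  then show ?thesis by (simp add: fourier_def measure_torus scaleR_conv_of_real)
next
  case False
  have "integrable torus (\<lambda>x. cis (- of_int k * x))"
    by (rule integrable_torus_bounded[OF cis_borel_torus, where B = 1]) simp
  then have "(LINT x|torus. cis (- of_int k * x)) = integral {0<..<2*pi} (\<lambda>x. cis (- of_int k * x))"
    by (intro lebesgue_integral_eq_integral) auto
  also have "\<dots> = integral {0..2*pi} (\<lambda>x. cis (- of_int k * x))"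
    by (rule integral_open_interval[of 0 "2 * pi", unfolded box_real cbox_interval])
  also have "\<dots> = 0"
  proof (rule integral_unique)
    have "((\<lambda>x. cis (- of_int k * x)) has_integral
        (\<i> / of_int k * cis (- of_int k * (2 * pi)) - \<i> / of_int k * cis (- of_int k * 0))) {0..2*pi}"
    proof (rule fundamental_theorem_of_calculus)
      fix x
      have "((\<lambda>x. \<i> / of_int k * cis (- of_int k * x)) has_vector_derivative
          \<i> / of_int k * (\<i> * of_real (- of_int k) * cis (- of_int k * x))) (at x within {0..2*pi})"
        by (intro has_vector_derivative_mult_right has_vector_derivative_cis_mult)
      then show "((\<lambda>x. \<i> / of_int k * cis (- of_int k * x)) has_vector_derivative
          cis (- of_int k * x)) (at x within {0..2*pi})"
        using False by simp
    qed auto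
    moreover have "cis (- of_int k * (2 * pi)) = 1"
      using cis_multiple_2pi[of "- of_int k"] by (simp add: mult.commute)
    ultimately show "((\<lambda>x. cis (- of_int k * x)) has_integral 0) {0..2*pi}" by simp
  qed
  finally show ?thesis using False by (simp add: fourier_def)
qed

section \<open>Absolutely convergent Fourier series and their coefficients\<close>

definition fseries :: "(int \<Rightarrow> complex) \<Rightarrow> real \<Rightarrow> complex" where
  "fseries c x = (\<Sum>\<^sub>\<infinity>k. c k * cis (of_int k * x))"

lemma fseries_uniform_limit:
  assumes "l1bound c C"
  shows "uniform_limit UNIV (\<lambda>L x. \<Sum>k\<in>L. c k * cis (of_int k * x)) (fseries c) (finite_subsets_at_top UNIV)"
  unfolding fseries_def[abs_def]
  by (rule Weierstrass_m_test_general[OF _ l1bound_summable[OF assms]]) (simp add: norm_mult)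

lemma fseries_continuous: "l1bound c C \<Longrightarrow> continuous_on UNIV (fseries c)"
  by (rule uniform_limit_theorem[OF _ fseries_uniform_limit])
    (auto intro!: always_eventually continuous_intros)

lemma fseries_measurable: "l1bound c C \<Longrightarrow> fseries c \<in> borel_measurable torus"
  by (rule continuous_borel_torus[OF fseries_continuous])

lemma fseries_bounded:
  assumes "l1bound c C"
  shows "cmod (fseries c x) \<le> C"
proof -
  have "cmod (fseries c x) \<le> (\<Sum>\<^sub>\<infinity>k. cmod (c k * cis (of_int k * x)))"
    unfolding fseries_def by (rule norm_infsum_bound) (simp add: norm_mult l1bound_summable[OF assms])
  also have "\<dots> \<le> C" using l1bound_infsum[OF assms] by (simp add: norm_mult)
  finally show ?thesis .
qed

lemma fseries_square_integrable: "l1bound c C \<Longrightarrow> square_integrable (fseries c)"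
  by (rule square_integrable_bounded[OF fseries_measurable fseries_bounded])

text \<open>The partial sums converge uniformly, so they may be integrated term by term against the
  integrable function \<open>v\<close>; multiplying by a monomial shifts the coefficients.\<close>

lemma fourier_mult_fseries:
  assumes v: "integrable torus v" and c: "l1bound c C"
  shows "((\<lambda>l. c l * fourier v (k - l)) has_sum fourier (\<lambda>x. v x * fseries c x) k) UNIV"
  unfolding has_sum_def
proof (rule tendstoI)
  fix e :: real assume e: "e > 0"
  define I where "I = (LINT x|torus. cmod (v x)) / (2 * pi)"
  have I: "I \<ge> 0" by (simp add: I_def)
  define d where "d = e / (I + 1)"
  have d: "d > 0" using e I by (simp add: d_def)
  have "\<forall>\<^sub>F L in finite_subsets_at_top UNIV. finite L"
    by (rule eventually_finite_subsets_at_top_weakI)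
  moreover have "\<forall>\<^sub>F L in finite_subsets_at_top UNIV. \<forall>x\<in>UNIV. dist (\<Sum>k\<in>L. c k * cis (of_int k * x)) (fseries c x) < d"
    using uniform_limitD[OF fseries_uniform_limit[OF c] d] .
  ultimately show "\<forall>\<^sub>F L in finite_subsets_at_top UNIV.
      dist (\<Sum>l\<in>L. c l * fourier v (k - l)) (fourier (\<lambda>x. v x * fseries c x) k) < e"
  proof eventually_elim
    case (elim L)
    define p where "p = (\<lambda>x. \<Sum>k\<in>L. c k * cis (of_int k * x))"
    have int1: "integrable torus (\<lambda>x. v x * fseries c x)"
      by (rule integrable_torus_mult[OF v fseries_measurable[OF c] fseries_bounded[OF c]])
    have int2: "integrable torus (\<lambda>x. c l * (v x * cis (of_int l * x)))" for l
      using integrable_torus_cis[OF v, of "of_int l"] by simp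
    have p_eq: "(\<lambda>x. v x * p x) = (\<lambda>x. \<Sum>l\<in>L. c l * (v x * cis (of_int l * x)))"
      by (simp add: p_def sum_distrib_left mult_ac)
    have int3: "integrable torus (\<lambda>x. v x * p x)"
      unfolding p_eq by (intro Bochner_Integration.integrable_sum int2)
    have "fourier (\<lambda>x. v x * p x) k = (\<Sum>l\<in>L. c l * fourier v (k - l))"
      unfolding p_eq using elim(1) int2 by (simp add: fourier_sum fourier_cmult fourier_shift)
    then have "dist (\<Sum>l\<in>L. c l * fourier v (k - l)) (fourier (\<lambda>x. v x * fseries c x) k)
        = cmod (fourier (\<lambda>x. v x * p x - v x * fseries c x) k)"
      by (simp add: dist_norm fourier_diff[OF int3 int1])
    also have "\<dots> \<le> (LINT x|torus. cmod (v x * p x - v x * fseries c x)) / (2 * pi)"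
      by (intro norm_fourier_le Bochner_Integration.integrable_diff int3 int1)
    also have "\<dots> \<le> (LINT x|torus. d * cmod (v x)) / (2 * pi)"
    proof (intro divide_right_mono integral_mono)
      fix x
      have "cmod (v x * p x - v x * fseries c x) = cmod (v x) * dist (p x) (fseries c x)"
        by (simp add: dist_norm flip: norm_mult right_diff_distrib)
      also have "\<dots> \<le> cmod (v x) * d"
        using elim(2) by (intro mult_left_mono) (auto simp: p_def intro: less_imp_le)
      finally show "cmod (v x * p x - v x * fseries c x) \<le> d * cmod (v x)" by (simp add: mult.commute)
    qed (use int1 int3 v in auto)
    also have "\<dots> = d * I" by (simp add: I_def)
    also have "\<dots> < e" using e I by (simp add: d_def field_simps)
    finally show ?case .
  qed
qed

lemma fourier_fseries:
  assumes "l1bound c C"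
  shows "fourier (fseries c) k = c k"
proof -
  have "integrable torus (\<lambda>_. 1 :: complex)" by (rule integrable_torus_bounded[where B = 1]) auto
  from fourier_mult_fseries[OF this assms, of k]
  have "((\<lambda>l. c l * (if k - l = 0 then 1 else 0)) has_sum fourier (fseries c) k) UNIV"
    by (simp add: fourier_one)
  moreover have "((\<lambda>l. c l * (if k - l = 0 then 1 else 0)) has_sum c k) UNIV"
    by (rule has_sum_finite_neutralI[of "{k}"]) auto
  ultimately show ?thesis by (rule has_sum_unique)
qed

section \<open>Completeness of the trigonometric system\<close>

inductive trig_poly :: "(real \<Rightarrow> complex) \<Rightarrow> bool" where
  trig_monom: "trig_poly (\<lambda>x. c * cis (of_int k * x))"
| trig_add: "trig_poly f \<Longrightarrow> trig_poly g \<Longrightarrow> trig_poly (\<lambda>x. f x + g x)"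

lemma trig_poly_const: "trig_poly (\<lambda>x. c)"
  using trig_monom[of c 0] by simp

lemma trig_poly_mult:
  assumes "trig_poly f" "trig_poly g"
  shows "trig_poly (\<lambda>x. f x * g x)"
  using assms(1)
proof induction
  case (trig_monom c k)
  show ?case
    using assms(2)
  proof induction
    case (trig_monom c' l)
    have "(\<lambda>x. c * cis (of_int k * x) * (c' * cis (of_int l * x))) = (\<lambda>x. c * c' * cis (of_int (k + l) * x))"
    proof
      fix x
      have "c * cis (of_int k * x) * (c' * cis (of_int l * x)) = c * c' * (cis (of_int k * x) * cis (of_int l * x))"
        by (simp only: mult_ac)
      then show "c * cis (of_int k * x) * (c' * cis (of_int l * x)) = c * c' * cis (of_int (k + l) * x)"
        by (simp add: cis_mult distrib_right)
    qed
    then show ?case by (simp only: trig_poly.trig_monom)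
  next
    case (trig_add f g)
    then show ?case using trig_poly.trig_add by (simp only: distrib_left)
  qed
next
  case (trig_add f g)
  then show ?case using trig_poly.trig_add by (simp only: distrib_right)
qed

lemma trig_poly_cos_sin: "trig_poly (\<lambda>x. of_real (cos x * a + sin x * b))"
proof -
  have "trig_poly (\<lambda>x. (of_real a / 2 + of_real b / (2 * \<i>)) * cis (of_int 1 * x)
      + (of_real a / 2 - of_real b / (2 * \<i>)) * cis (of_int (- 1) * x))"
    by (intro trig_add trig_monom)
  also have "(\<lambda>x. (of_real a / 2 + of_real b / (2 * \<i>)) * cis (of_int 1 * x)
      + (of_real a / 2 - of_real b / (2 * \<i>)) * cis (of_int (- 1) * x)) = (\<lambda>x. of_real (cos x * a + sin x * b))"
    by (auto simp: fun_eq_iff complex_eq_iff Re_divide Im_divide power2_eq_square algebra_simps)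
  finally show ?thesis .
qed

lemma real_polynomial_function_trig_poly:
  fixes p :: "complex \<Rightarrow> real"
  assumes "real_polynomial_function p"
  shows "trig_poly (\<lambda>x. of_real (p (cis x)))"
  using assms
proof induction
  case (linear f)
  interpret bounded_linear f by fact
  have "f (cis x) = cos x * f 1 + sin x * f \<i>" for x
  proof -
    have "cis x = cos x *\<^sub>R 1 + sin x *\<^sub>R \<i>" by (simp add: complex_eq_iff)
    then show ?thesis by (simp only: add scaleR real_scaleR_def)
  qed
  then show ?case by (simp only: trig_poly_cos_sin)
next
  case (const c)
  show ?case by (rule trig_poly_const)
next
  case (add f g)
  then show ?case using trig_add by (simp only: of_real_add)
next
  case (mult f g)
  then show ?case using trig_poly_mult by (simp only: of_real_mult)
qed

text \<open>The endpoint condition lets \<open>\<psi>\<close> descend to a continuous function on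
  the unit circle. Stone-Weierstrass gives a polynomial in the two real coordinates there, and along
  \<open>cis\<close> such polynomials are trigonometric.\<close>

lemma trig_poly_approx:
  fixes \<psi> :: "real \<Rightarrow> complex"
  assumes cont: "continuous_on {0..2*pi} \<psi>" and per: "\<psi> 0 = \<psi> (2 * pi)" and e: "e > 0"
  obtains f where "trig_poly f" "\<And>x. x \<in> {0<..<2*pi} \<Longrightarrow> cmod (\<psi> x - f x) < e"
proof -
  define p where "p = (\<lambda>t. \<psi> (2 * pi * t))"
  have "path p"
    unfolding path_def p_def
    by (rule continuous_on_compose2[OF cont]) (auto intro!: continuous_intros)
  \<comment> \<open>The trivial homotopy serves to obtain continuity of \<open>p\<close> composed
    with the angle on the whole circle, including the point 1 where \<open>Arg2pi\<close>
    jumps.\<close>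
  then have "homotopic_loops UNIV p p"
    using per by (simp add: homotopic_loops_refl p_def pathfinish_def pathstart_def)
  from homotopic_loops_imp_homotopic_circlemaps[OF this]
  have "continuous_on (sphere 0 1) (p \<circ> (\<lambda>z. Arg2pi z / (2 * pi)))"
    using homotopic_with_imp_continuous by blast
  from Stone_Weierstrass_polynomial_function[OF _ this e]
  obtain g where g: "polynomial_function g" and
    close: "\<And>z. z \<in> sphere 0 1 \<Longrightarrow> cmod ((p \<circ> (\<lambda>z. Arg2pi z / (2 * pi))) z - g z) < e"
    by auto
  have "real_polynomial_function (Re \<circ> g)" "real_polynomial_function (Im \<circ> g)"
    using g bounded_linear_Re bounded_linear_Im unfolding polynomial_function_def by blast+
  then have "trig_poly (\<lambda>x. of_real ((Re \<circ> g) (cis x)) + \<i> * of_real ((Im \<circ> g) (cis x)))"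
    by (intro trig_add trig_poly_mult trig_poly_const real_polynomial_function_trig_poly)
  moreover have "(\<lambda>x. of_real ((Re \<circ> g) (cis x)) + \<i> * of_real ((Im \<circ> g) (cis x))) = (\<lambda>x. g (cis x))"
    by (simp add: fun_eq_iff complex_eq_iff)
  ultimately have "trig_poly (\<lambda>x. g (cis x))" by simp
  moreover have "cmod (\<psi> x - g (cis x)) < e" if "x \<in> {0<..<2*pi}" for x
  proof -
    have "Arg2pi (cis x) = x"
      by (rule Arg2pi_unique[of 1]) (use that in \<open>auto simp: cis_conv_exp\<close>)
    then show ?thesis using close[of "cis x"] by (simp add: p_def)
  qed
  ultimately show thesis by (rule that)
qed

lemma integral_trig_poly_zero:
  assumes g: "integrable torus g" and zero: "\<And>k. fourier g k = 0" and "trig_poly f"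
  shows "integrable torus (\<lambda>x. g x * f x) \<and> (LINT x|torus. g x * f x) = 0"
  using assms(3)
proof induction
  case (trig_monom c k)
  have "integrable torus (\<lambda>x. c * (g x * cis (of_int k * x)))"
    using integrable_torus_cis[OF g, of "of_int k"] by simp
  moreover have "(LINT x|torus. c * (g x * cis (of_int k * x))) = 0"
    using zero[of "- k"] by (simp add: fourier_def)
  ultimately show ?case by (simp add: mult_ac)
next
  case (trig_add f h)
  then show ?case by (simp add: distrib_left)
qed

lemma integral_continuous_zero:
  assumes g: "integrable torus g" and zero: "\<And>k. fourier g k = 0"
    and cont: "continuous_on UNIV \<psi>" and per: "\<psi> 0 = \<psi> (2 * pi)" and bd: "\<And>x. x \<in> {0<..<2*pi} \<Longrightarrow> cmod (\<psi> x) \<le> B"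
  shows "(LINT x|torus. g x * \<psi> x) = 0"
proof -
  define I where "I = (LINT x|torus. cmod (g x))"
  have I: "I \<ge> 0" by (simp add: I_def)
  have int: "integrable torus (\<lambda>x. g x * \<psi> x)"
    by (rule integrable_torus_mult[OF g continuous_borel_torus[OF cont] bd])
  have "cmod (LINT x|torus. g x * \<psi> x) \<le> 0 + e" if e: "e > 0" for e
  proof -
    define d where "d = e / (I + 1)"
    have d: "d > 0" using e I by (simp add: d_def)
    obtain f where f: "trig_poly f" "\<And>x. x \<in> {0<..<2*pi} \<Longrightarrow> cmod (\<psi> x - f x) < d"
      using trig_poly_approx[OF continuous_on_subset[OF cont subset_UNIV] per d] by blast
    note gf = integral_trig_poly_zero[OF g zero f(1)]
    have "(LINT x|torus. g x * \<psi> x) = (LINT x|torus. g x * \<psi> x - g x * f x)"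
      using gf int by (simp add: Bochner_Integration.integral_diff)
    also have "cmod \<dots> \<le> (LINT x|torus. d * cmod (g x))"
    proof (rule Bochner_Integration.integral_norm_bound_integral)
      fix x assume "x \<in> space torus"
      then have "cmod (g x) * cmod (\<psi> x - f x) \<le> cmod (g x) * d"
        using f(2)[of x] by (intro mult_left_mono) auto
      then show "cmod (g x * \<psi> x - g x * f x) \<le> d * cmod (g x)"
        by (simp only: right_diff_distrib[symmetric] norm_mult mult.commute[of d])
    qed (use gf int g in auto)
    also have "\<dots> = d * I" by (simp add: I_def)
    also have "\<dots> \<le> e" using e I by (simp add: d_def field_simps)
    finally show ?thesis by simp
  qed
  then have "cmod (LINT x|torus. g x * \<psi> x) \<le> 0" by (rule field_le_epsilon)
  then show ?thesis by simp
qed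

text \<open>The phase of \<open>g\<close> is an almost everywhere limit of bounded continuous functions, which a cutoff
  makes periodic; testing against them gives \<open>\<integral> |g| = 0\<close>.\<close>

lemma fourier_zero_imp_AE_zero:
  assumes g: "integrable torus g" and zero: "\<And>k. fourier g k = 0"
  shows "AE x in torus. g x = 0"
proof -
  have gm: "g \<in> borel_measurable torus" using g by auto
  define h where "h = (\<lambda>x. cnj (sgn (g x)))"
  have hm: "h \<in> borel_measurable torus"
    unfolding h_def
    by (rule measurable_compose[OF measurable_compose[OF gm borel_measurable_sgn]]) (intro borel_measurable_continuous_onI continuous_intros)
  then have "h measurable_on {0<..<2*pi}"
    by (subst measurable_on_iff_borel_measurable) auto
  then obtain N G where N: "negligible N" and G: "\<And>n. continuous_on UNIV (G n)"
    and lim: "\<And>x. x \<notin> N \<Longrightarrow> (\<lambda>n. G n x) \<longlonglongrightarrow> (if x \<in> {0<..<2*pi} then h x else 0)"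
    unfolding measurable_on_def by blast
  \<comment> \<open>Vanishes at both endpoints and equals 1 at any given interior point for all
    large \<open>n\<close>.\<close>
  define cut where "cut = (\<lambda>n x. min 1 (real n * min x (2 * pi - x)))"
  \<comment> \<open>Radial projection onto the closed unit disc. It supplies the bound needed for
    dominated convergence, which \<open>G n\<close> need not satisfy, and fixes the values of
    \<open>h\<close>.\<close>
  define clamp where "clamp = (\<lambda>z::complex. z / of_real (max 1 (cmod z)))"
  define \<psi> where "\<psi> = (\<lambda>n x. of_real (cut n x) * clamp (G n x))"
  have clamp_cont: "continuous_on UNIV clamp"
    unfolding clamp_def by (intro continuous_intros) auto
  have clamp_bd: "cmod (clamp z) \<le> 1" for z
    by (simp add: clamp_def norm_divide divide_le_eq max_def)
  have \<psi>_cont: "continuous_on UNIV (\<psi> n)" for n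
    unfolding \<psi>_def cut_def
    by (intro continuous_intros continuous_on_compose2[OF clamp_cont G]) auto
  have \<psi>_bd: "cmod (\<psi> n x) \<le> 1" if "x \<in> {0<..<2*pi}" for n x
  proof -
    have "0 \<le> cut n x" "cut n x \<le> 1" using that by (auto simp: cut_def)
    then show ?thesis
      using clamp_bd[of "G n x"] by (simp add: \<psi>_def norm_mult mult_le_one)
  qed
  have \<psi>_per: "\<psi> n 0 = \<psi> n (2 * pi)" for n
    by (simp add: \<psi>_def cut_def)
  have "(\<lambda>n. LINT x|torus. g x * \<psi> n x) \<longlonglongrightarrow> (LINT x|torus. g x * h x)"
  proof (rule integral_dominated_convergence[where w = "\<lambda>x. cmod (g x)"])
    show "(\<lambda>x. g x * h x) \<in> borel_measurable torus" using gm hm by measurable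
    show "(\<lambda>x. g x * \<psi> n x) \<in> borel_measurable torus" for n
      using gm continuous_borel_torus[OF \<psi>_cont, of n] by measurable
    show "integrable torus (\<lambda>x. cmod (g x))" using g by simp
    show "AE x in torus. norm (g x * \<psi> n x) \<le> cmod (g x)" for n
      using \<psi>_bd by (intro AE_I2) (simp add: norm_mult mult_left_le)
    have "AE x in lebesgue. x \<notin> N"
      using N by (simp add: AE_not_in negligible_iff_null_sets)
    then have "AE x in torus. x \<notin> N"
      by (subst AE_restrict_space_iff) auto
    moreover have "AE x in torus. x \<in> {0<..<2*pi}"
      by (intro AE_I2) simp
    ultimately show "AE x in torus. (\<lambda>n. g x * \<psi> n x) \<longlonglongrightarrow> g x * h x"
    proof eventually_elim
      case (elim x)
      have "(\<lambda>n. clamp (G n x)) \<longlonglongrightarrow> clamp (h x)"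
        using lim[OF elim(1)] elim(2) clamp_cont
        by (intro isCont_tendsto_compose[of _ clamp]) (auto simp: continuous_on_eq_continuous_at)
      moreover have "clamp (h x) = h x"
        by (auto simp: clamp_def h_def norm_sgn)
      moreover have "\<forall>\<^sub>F n in sequentially. 1 = complex_of_real (cut n x)"
      proof -
        define m where "m = min x (2 * pi - x)"
        have m: "m > 0" using elim(2) by (simp add: m_def)
        obtain n0 where "1 / m \<le> real n0" using real_arch_simple by blast
        then have "1 \<le> real n * m" if "n \<ge> n0" for n
          using m that order_trans[of "1 / m" "real n0" "real n"] by (simp add: pos_divide_le_eq)
        then show ?thesis
          unfolding eventually_sequentially cut_def m_def[symmetric]
          by (intro exI[of _ n0]) (simp add: min_absorb1)
      qed
      then have "(\<lambda>n. complex_of_real (cut n x)) \<longlonglongrightarrow> 1"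
        by (rule Lim_transform_eventually[OF tendsto_const])
      ultimately have "(\<lambda>n. g x * (of_real (cut n x) * clamp (G n x))) \<longlonglongrightarrow> g x * (1 * h x)"
        by (intro tendsto_intros) simp_all
      then show ?case by (simp add: \<psi>_def)
    qed
  qed
  moreover have "(LINT x|torus. g x * \<psi> n x) = 0" for n
    by (rule integral_continuous_zero[OF g zero \<psi>_cont \<psi>_per \<psi>_bd])
  ultimately have "(LINT x|torus. g x * h x) = 0"
    by (simp add: LIMSEQ_const_iff)
  moreover have "g x * h x = of_real (cmod (g x))" for x
  proof -
    have "g x * h x * of_real (cmod (g x)) = g x * cnj (g x)"
      by (cases "g x = 0") (simp_all add: h_def sgn_eq)
    also have "\<dots> = of_real (cmod (g x)) * of_real (cmod (g x))"
      by (simp add: complex_norm_square[symmetric] power2_eq_square)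
    finally show ?thesis by (cases "g x = 0") (auto simp: h_def)
  qed
  ultimately have "(LINT x|torus. cmod (g x)) = 0" by simp
  then have "AE x in torus. cmod (g x) = 0"
    using g by (subst (asm) integral_nonneg_eq_0_iff_AE) auto
  then show ?thesis by simp
qed

section \<open>Sobolev norms in terms of Fourier coefficients\<close>

text \<open>The form in which completeness is used: it allows a factor of a product to be replaced
  by its Fourier series.\<close>

lemma fourier_coeffs_AE_unique:
  assumes f: "integrable torus f" and c: "l1bound c C" and eq: "\<And>k. fourier f k = c k"
  shows "AE x in torus. f x = fseries c x"
proof -
  have s: "integrable torus (fseries c)"
    by (rule square_integrable_imp_integrable[OF fseries_square_integrable[OF c]])
  have "AE x in torus. f x - fseries c x = 0"
    by (rule fourier_zero_imp_AE_zero) (use f s in \<open>simp_all add: fourier_diff fourier_fseries[OF c] eq\<close>)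
  then show ?thesis by simp
qed

lemma hnorm_nonneg [simp]: "hnorm r f \<ge> 0"
  by (simp add: hnorm_def infsum_nonneg)

lemma sobolev_hbound:
  assumes "f \<in> sobolev r"
  shows "hbound r (fourier f) (hnorm r f / sqrt (2 * pi))"
  unfolding hbound_def
proof (intro allI impI)
  fix S :: "int set" assume S: "finite S"
  have "(\<Sum>k\<in>S. (weight r k * cmod (fourier f k))\<^sup>2) = (\<Sum>k\<in>S. (1 + (of_int k)\<^sup>2) powr r * (cmod (fourier f k))\<^sup>2)"
    by (simp add: power_mult_distrib weight_square)
  also have "\<dots> \<le> (\<Sum>\<^sub>\<infinity>k::int. (1 + (of_int k)\<^sup>2) powr r * (cmod (fourier f k))\<^sup>2)"
    by (rule finite_sum_le_infsum) (use assms S in \<open>auto simp: sobolev_def\<close>)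
  finally show "L2_set (\<lambda>k. weight r k * cmod (fourier f k)) S \<le> hnorm r f / sqrt (2 * pi)"
    by (simp add: L2_set_def hnorm_def real_sqrt_mult)
qed

lemma hbound_sobolev:
  assumes f: "square_integrable f" and M: "hbound r (fourier f) M"
  shows "f \<in> sobolev r" and "hnorm r f \<le> sqrt (2 * pi) * M"
proof -
  define g where "g = (\<lambda>k::int. (1 + (of_int k)\<^sup>2) powr r * (cmod (fourier f k))\<^sup>2)"
  have M0: "M \<ge> 0" using hbound_nonneg[OF M] .
  have le: "sum g S \<le> M\<^sup>2" if S: "finite S" for S
  proof -
    have "sum g S = (L2_set (\<lambda>k. weight r k * cmod (fourier f k)) S)\<^sup>2"
      by (simp add: g_def L2_set_def power_mult_distrib weight_square sum_nonneg)
    also have "\<dots> \<le> M\<^sup>2" by (intro power_mono hboundD[OF M S]) auto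
    finally show ?thesis .
  qed
  have summ: "g summable_on UNIV"
    by (rule nonneg_bdd_above_summable_on) (auto simp: g_def[abs_def] intro!: bdd_aboveI2 le[unfolded g_def])
  then show "f \<in> sobolev r" using f by (simp add: sobolev_def g_def)
  have "infsum g UNIV \<le> M\<^sup>2" by (rule infsum_le_finite_sums[OF summ le])
  then have "sqrt (infsum g UNIV) \<le> M" using M0 by (simp add: real_le_lsqrt)
  then show "hnorm r f \<le> sqrt (2 * pi) * M"
    unfolding hnorm_def g_def[symmetric] real_sqrt_mult by (intro mult_left_mono) auto
qed

lemma sobolev_square_integrable: "f \<in> sobolev r \<Longrightarrow> square_integrable f"
  by (simp add: sobolev_def)

lemma sobolev_integrable: "f \<in> sobolev r \<Longrightarrow> integrable torus f"
  by (simp add: sobolev_square_integrable square_integrable_imp_integrable)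

lemma sobolev_diff_hbound:
  assumes "f \<in> sobolev r" "g \<in> sobolev r"
  shows "(\<lambda>x. f x - g x) \<in> sobolev r"
    and "hbound r (\<lambda>k. fourier f k - fourier g k) (hnorm r (\<lambda>x. f x - g x) / sqrt (2 * pi))"
proof -
  have f: "fourier (\<lambda>x. f x - g x) = (\<lambda>k. fourier f k - fourier g k)"
    using assms by (simp add: fun_eq_iff fourier_diff sobolev_integrable)
  have "hbound r (fourier (\<lambda>x. f x - g x)) (hnorm r f / sqrt (2 * pi) + hnorm r g / sqrt (2 * pi))"
    unfolding f by (intro hbound_minus sobolev_hbound assms)
  then show *: "(\<lambda>x. f x - g x) \<in> sobolev r"
    using hbound_sobolev(1) square_integrable_diff assms[THEN sobolev_square_integrable] by blast
  show "hbound r (\<lambda>k. fourier f k - fourier g k) (hnorm r (\<lambda>x. f x - g x) / sqrt (2 * pi))"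
    using sobolev_hbound[OF *] by (simp add: f)
qed

lemma hnorm_triangle:
  assumes "f \<in> sobolev r" "g \<in> sobolev r"
  shows "hnorm r f \<le> hnorm r g + hnorm r (\<lambda>x. f x - g x)"
proof -
  have "hbound r (\<lambda>k. fourier g k + (fourier f k - fourier g k))
      (hnorm r g / sqrt (2 * pi) + hnorm r (\<lambda>x. f x - g x) / sqrt (2 * pi))"
    by (intro hbound_add sobolev_hbound sobolev_diff_hbound assms)
  then have "hnorm r f \<le> sqrt (2 * pi) * (hnorm r g / sqrt (2 * pi) + hnorm r (\<lambda>x. f x - g x) / sqrt (2 * pi))"
    by (intro hbound_sobolev(2)) (use assms sobolev_square_integrable in auto)
  also have "\<dots> = hnorm r g + hnorm r (\<lambda>x. f x - g x)"
    by (simp add: distrib_left)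
  finally show ?thesis .
qed

lemma hnorm_diff_commute: "hnorm r (\<lambda>x. f x - g x) = hnorm r (\<lambda>x. g x - f x)"
proof -
  have "fourier (\<lambda>x. f x - g x) k = - fourier (\<lambda>x. g x - f x) k" for k
    using fourier_cmult[of "-1" "\<lambda>x. g x - f x" k] by simp
  then show ?thesis by (simp add: hnorm_def)
qed

section \<open>Products of functions\<close>

text \<open>The Fourier coefficients of the complex conjugate, see
  \<open>fourier_cnj\<close>.\<close>

definition reflect :: "(int \<Rightarrow> complex) \<Rightarrow> int \<Rightarrow> complex" where
  "reflect c k = cnj (c (- k))"

text \<open>The passage to the interaction picture, inverse to the free group:
  \<open>schroedinger_group t\<close> acts as \<open>twist (- t)\<close>.\<close>

definition twist :: "real \<Rightarrow> (int \<Rightarrow> complex) \<Rightarrow> int \<Rightarrow> complex" where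
  "twist t c k = cis ((of_int k)\<^sup>2 * t) * c k"

definition inv_symbol :: "(int \<Rightarrow> complex) \<Rightarrow> int \<Rightarrow> complex" where
  "inv_symbol c k = (if k = 0 then 0 else c k / (\<i> * of_int k))"

abbreviation conv :: "(int \<Rightarrow> complex) \<Rightarrow> (int \<Rightarrow> complex) \<Rightarrow> int \<Rightarrow> complex" where
  "conv \<equiv> bilin (\<lambda>_ _. 1)"

lemma l1bound_norm_mono:
  assumes "l1bound a M" "\<And>k. cmod (b k) \<le> cmod (a k)"
  shows "l1bound b M"
  using assms unfolding l1bound_def by (meson order_trans sum_mono)

lemma l1bound_reflect:
  assumes "l1bound c C"
  shows "l1bound (reflect c) C"
  unfolding l1bound_def
proof (intro allI impI)
  fix S :: "int set" assume "finite S"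
  have "(\<Sum>k\<in>S. cmod (reflect c k)) = (\<Sum>k\<in>uminus ` S. cmod (c k))"
    by (subst sum.reindex) (auto simp: reflect_def)
  then show "(\<Sum>k\<in>S. cmod (reflect c k)) \<le> C"
    using assms \<open>finite S\<close> by (simp add: l1bound_def)
qed

lemma norm_twist [simp]: "cmod (twist t c k) = cmod (c k)"
  by (simp add: twist_def norm_mult)

lemma twist_twist: "twist t (twist s c) = twist (t + s) c"
  by (simp add: twist_def fun_eq_iff cis_mult distrib_left flip: mult.assoc)

lemma twist_0 [simp]: "twist 0 c = c"
  by (simp add: twist_def fun_eq_iff)

lemma norm_inv_symbol: "cmod (inv_symbol c k) \<le> cmod (c k)"
proof (cases "k = 0")
  case False
  then have "1 \<le> \<bar>real_of_int k\<bar>" by linarith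
  then have "cmod (c k) * 1 \<le> cmod (c k) * \<bar>real_of_int k\<bar>" by (intro mult_left_mono) auto
  then show ?thesis
    using False by (simp add: inv_symbol_def norm_divide norm_mult divide_le_eq)
qed (simp add: inv_symbol_def)

lemma l1bound_twist: "l1bound c C \<Longrightarrow> l1bound (twist t c) C"
  by (rule l1bound_norm_mono) auto

lemma l1bound_inv_symbol: "l1bound c C \<Longrightarrow> l1bound (inv_symbol c) C"
  by (rule l1bound_norm_mono) (auto intro: norm_inv_symbol)

lemma hbound_twist: "hbound r (twist t c) M \<longleftrightarrow> hbound r c M"
  by (rule hbound_norm_cong) simp

lemma hbound_inv_symbol: "hbound r c M \<Longrightarrow> hbound r (inv_symbol c) M"
  by (rule hbound_norm_mono) (auto intro: norm_inv_symbol)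

text \<open>The phase of \<open>osc\<close> and those of the two factors multiply to a phase that
  depends on \<open>k\<close> alone and leaves the sum.\<close>

lemma bilin_osc_twist: "bilin (osc t) (twist t a) (twist t b) = twist t (conv a b)"
proof
  fix k
  have "osc t k l * (twist t a (k + l) * cnj (twist t b l)) = cis ((of_int k)\<^sup>2 * t) * (1 * (a (k + l) * cnj (b l)))" for l
  proof -
    have "osc t k l * (cis ((of_int (k + l))\<^sup>2 * t) * cnj (cis ((of_int l)\<^sup>2 * t))) = cis ((of_int k)\<^sup>2 * t)"
      by (simp add: osc_def cis_cnj cis_mult algebra_simps power2_eq_square)
    then show ?thesis
      by (simp add: twist_def mult_ac)
  qed
  then show "bilin (osc t) (twist t a) (twist t b) k = twist t (conv a b) k"
    unfolding bilin_def twist_def[of t "bilin _ _ _"] by (simp only: infsum_cmult_right')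
qed

lemma fourier_mult_reflect:
  assumes v: "integrable torus v" and V: "l1bound (fourier v) C" and D: "l1bound D E"
  shows "fourier (\<lambda>x. v x * fseries (reflect D) x) k = conv (fourier v) D k"
proof -
  have "((\<lambda>l. reflect D l * fourier v (k - l)) has_sum fourier (\<lambda>x. v x * fseries (reflect D) x) k) UNIV"
    by (rule fourier_mult_fseries[OF v l1bound_reflect[OF D]])
  then have "((\<lambda>l. reflect D (- l) * fourier v (k - - l)) has_sum fourier (\<lambda>x. v x * fseries (reflect D) x) k) UNIV"
    by (subst (asm) has_sum_reindex_bij_betw[of uminus UNIV UNIV, symmetric]) (auto intro!: bij_uminus)
  then have "((\<lambda>l. 1 * (fourier v (k + l) * cnj (D l))) has_sum fourier (\<lambda>x. v x * fseries (reflect D) x) k) UNIV"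
    by (simp add: reflect_def mult.commute)
  moreover have "((\<lambda>l. 1 * (fourier v (k + l) * cnj (D l))) has_sum conv (fourier v) D k) UNIV"
    by (rule bilin_has_sum[OF _ V D, of _ 1]) simp
  ultimately show ?thesis by (rule has_sum_unique)
qed

lemma sobolev_l1bound: "r > 1/2 \<Longrightarrow> v \<in> sobolev r \<Longrightarrow> \<exists>C. l1bound (fourier v) C"
  using hbound_imp_l1bound sobolev_hbound by blast

text \<open>|v|^2 is \<open>v\<close> times its conjugate, and the conjugate is almost everywhere
  the series with the reflected coefficients, to which \<open>fourier_mult_reflect\<close>
  applies.\<close>

lemma fourier_norm_square:
  assumes r: "r > 1/2" and v: "v \<in> sobolev r"
  shows "fourier (\<lambda>x. of_real ((cmod (v x))\<^sup>2)) k = conv (fourier v) (fourier v) k"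
proof -
  obtain C where C: "l1bound (fourier v) C" using sobolev_l1bound[OF r v] by blast
  have vi: "integrable torus v" by (rule sobolev_integrable[OF v])
  have "AE x in torus. cnj (v x) = fseries (reflect (fourier v)) x"
    by (rule fourier_coeffs_AE_unique[OF _ l1bound_reflect[OF C]])
      (use vi in \<open>auto simp: fourier_cnj reflect_def\<close>)
  then have "AE x in torus. of_real ((cmod (v x))\<^sup>2) = v x * fseries (reflect (fourier v)) x"
  proof eventually_elim
    case (elim x)
    then show ?case by (simp only: complex_norm_square)
  qed
  then have "fourier (\<lambda>x. of_real ((cmod (v x))\<^sup>2)) k = fourier (\<lambda>x. v x * fseries (reflect (fourier v)) x) k"
  proof (rule fourier_cong_AE)
    have [measurable]: "v \<in> borel_measurable torus" using vi by auto
    note [measurable] = fseries_measurable[OF l1bound_reflect[OF C]]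
    show "(\<lambda>x. complex_of_real ((cmod (v x))\<^sup>2)) \<in> borel_measurable torus" by measurable
    show "(\<lambda>x. v x * fseries (reflect (fourier v)) x) \<in> borel_measurable torus" by measurable
  qed
  then show ?thesis using fourier_mult_reflect[OF vi C C] by simp
qed

lemma l2norm_square:
  assumes "r > 1/2" "v \<in> sobolev r"
  shows "of_real ((l2norm v)\<^sup>2) = of_real (2 * pi) * conv (fourier v) (fourier v) 0"
proof -
  have "(l2norm v)\<^sup>2 = (LINT x|torus. (cmod (v x))\<^sup>2)"
    by (simp add: l2norm_def)
  then have "of_real ((l2norm v)\<^sup>2) = of_real (2 * pi) * fourier (\<lambda>x. of_real ((cmod (v x))\<^sup>2)) 0"
    by (simp add: fourier_def flip: of_real_power)
  then show ?thesis using fourier_norm_square[OF assms] by simp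
qed

section \<open>The propagators on the Fourier side\<close>

lemma schroedinger_group_fseries: "schroedinger_group t f = fseries (twist (- t) (fourier f))"
  by (simp add: fun_eq_iff schroedinger_group_def fseries_def twist_def mult.commute)

lemma inv_deriv_fseries: "inv_deriv f = fseries (inv_symbol (fourier f))"
  unfolding fun_eq_iff inv_deriv_def fseries_def
  by (intro allI infsum_cong_neutral) (auto simp: inv_symbol_def)

lemma inv_deriv_cnj: "inv_deriv (\<lambda>x. cnj (v x)) = fseries (reflect (inv_symbol (fourier v)))"
  unfolding inv_deriv_fseries
  by (rule arg_cong[where f = fseries]) (auto simp: fun_eq_iff inv_symbol_def reflect_def fourier_cnj)

lemma reflect_twist: "twist t (reflect c) = reflect (twist (- t) c)"
  by (simp add: fun_eq_iff twist_def reflect_def cis_cnj)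

lemma conv_twist: "conv (twist (- t) a) (twist (- t) b) = twist (- t) (bilin (osc t) a b)"
  using arg_cong[OF bilin_osc_twist[of t "twist (- t) a" "twist (- t) b"], of "twist (- t)"]
  by (simp add: twist_twist)

text \<open>The inner derivative in \<^const>\<open>Phi_c1\<close> produces the factor \<open>l\<close> and the outer one the factor \<open>k\<close>
  of the denominator \<open>k l\<close> in \<^const>\<open>prim\<close>; the modes \<open>k = 0\<close> and \<open>l = 0\<close> are the explicit terms.\<close>

lemma bilin_prim_zero: "bilin (prim t) V V 0 = of_real t * conv V V 0"
  unfolding bilin_def prim_def by (simp add: infsum_cmult_right')

lemma bilin_prim_nonzero:
  assumes V: "l1bound V C" and k: "k \<noteq> 0"
  shows "bilin (prim t) V V k
    = (bilin (osc t) V (inv_symbol V) k - conv V (inv_symbol V) k) / (2 * of_int k) + of_real t * V k * cnj (V 0)"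
proof -
  note D = l1bound_inv_symbol[OF V]
  \<comment> \<open>The conjugate of \<open>1 / (\<i> * l)\<close> is
    \<open>1 / (- \<i> * l)\<close>, so \<open>c\<close> completes it to the denominator of
    \<open>prim\<close>. Since \<open>inv_symbol V 0 = 0\<close>, the mode \<open>l = 0\<close> is
    added separately.\<close>
  define c :: complex where "c = 1 / (2 * of_int k)"
  have "((\<lambda>l. c * (osc t k l * (V (k + l) * cnj (inv_symbol V l))) + - c * (1 * (V (k + l) * cnj (inv_symbol V l)))
      + (if l = 0 then of_real t * V k * cnj (V 0) else 0))
     has_sum (c * bilin (osc t) V (inv_symbol V) k + - c * conv V (inv_symbol V) k + of_real t * V k * cnj (V 0))) UNIV"
  proof (intro has_sum_add has_sum_cmult_right)
    show "((\<lambda>l. osc t k l * (V (k + l) * cnj (inv_symbol V l))) has_sum bilin (osc t) V (inv_symbol V) k) UNIV"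
      by (rule bilin_has_sum[OF _ V D, of _ 1]) simp
    show "((\<lambda>l. 1 * (V (k + l) * cnj (inv_symbol V l))) has_sum conv V (inv_symbol V) k) UNIV"
      by (rule bilin_has_sum[OF _ V D, of _ 1]) simp
    show "((\<lambda>l. if l = 0 then of_real t * V k * cnj (V 0) else 0) has_sum of_real t * V k * cnj (V 0)) UNIV"
      by (rule has_sum_finite_neutralI[of "{0}"]) auto
  qed
  moreover have "c * (osc t k l * (V (k + l) * cnj (inv_symbol V l))) + - c * (1 * (V (k + l) * cnj (inv_symbol V l)))
      + (if l = 0 then of_real t * V k * cnj (V 0) else 0) = prim t k l * (V (k + l) * cnj (V l))" for l
    using k by (cases "l = 0") (simp_all add: prim_def inv_symbol_def c_def field_simps)
  ultimately have "((\<lambda>l. prim t k l * (V (k + l) * cnj (V l))) has_sum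
      (c * bilin (osc t) V (inv_symbol V) k + - c * conv V (inv_symbol V) k + of_real t * V k * cnj (V 0))) UNIV"
    by simp
  then show ?thesis
    unfolding bilin_def[of "prim t"] by (subst infsumI) (auto simp: c_def diff_divide_distrib)
qed

text \<open>The closed formula is exactly the Duhamel integral with frozen profile, transported back
  by the free group. All estimates of the coarse propagator go through this identity.\<close>

lemma Phi_c1_fourier:
  assumes r: "r > 1/2" and v: "v \<in> sobolev r"
  shows "square_integrable (Phi_c1 \<mu> \<tau> v)"
    and "fourier (Phi_c1 \<mu> \<tau> v) k = - \<i> * \<mu> * twist (- \<tau>) (bilin (prim \<tau>) (fourier v) (fourier v)) k"
proof -
  define V where "V = fourier v"
  define D where "D = inv_symbol V"
  have vi: "integrable torus v" by (rule sobolev_integrable[OF v])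
  obtain A where A: "hbound r V A" using sobolev_hbound[OF v] by (auto simp: V_def)
  have DA: "hbound r D A" unfolding D_def by (rule hbound_inv_symbol[OF A])
  obtain C where C: "l1bound V C" using hbound_imp_l1bound[OF r A] by blast
  have DC: "l1bound D C" unfolding D_def by (rule l1bound_inv_symbol[OF C])
  have hb_conv: "hbound r (conv V D) (1 * bilin_const r * A * A)"
    by (rule bilin_bound[OF r _ A DA]) simp
  obtain E where E: "l1bound (conv V D) E"
    using hbound_imp_l1bound[OF r hb_conv] by blast
  define f1 where "f1 = schroedinger_group \<tau> v"
  have f1: "f1 = fseries (twist (- \<tau>) V)" by (simp add: f1_def schroedinger_group_fseries V_def)
  have f1s: "square_integrable f1" unfolding f1 by (rule fseries_square_integrable[OF l1bound_twist[OF C]])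
  have f1_four: "fourier f1 = twist (- \<tau>) V"
    unfolding f1 by (simp add: fun_eq_iff fourier_fseries[OF l1bound_twist[OF C]])
  define f2 where "f2 = schroedinger_group (- \<tau>) (inv_deriv (\<lambda>z. cnj (v z)))"
  \<comment> \<open>The group with reversed time, applied to a conjugate, is the conjugate of the
    forward group.\<close>
  have f2: "f2 = fseries (reflect (twist (- \<tau>) D))"
  proof -
    have "fourier (fseries (reflect D)) = reflect D"
      by (simp add: fun_eq_iff fourier_fseries[OF l1bound_reflect[OF DC]])
    then show ?thesis
      by (simp add: f2_def inv_deriv_cnj schroedinger_group_fseries reflect_twist D_def V_def)
  qed
  define f3 where "f3 = schroedinger_group \<tau> (\<lambda>z. v z * inv_deriv (\<lambda>z'. cnj (v z')) z)"
  have f3: "f3 = fseries (twist (- \<tau>) (conv V D))"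
  proof -
    have "fourier (\<lambda>z. v z * fseries (reflect D) z) = conv V D"
      using fourier_mult_reflect[OF vi _ DC] C by (auto simp: fun_eq_iff V_def)
    then show ?thesis
      by (simp add: f3_def inv_deriv_cnj schroedinger_group_fseries D_def V_def)
  qed
  define g where "g = (\<lambda>y. f1 y * f2 y - f3 y)"
  have f1i: "integrable torus f1" by (rule square_integrable_imp_integrable[OF f1s])
  have f12i: "integrable torus (\<lambda>y. f1 y * f2 y)"
    unfolding f2 by (rule integrable_torus_mult[OF f1i fseries_measurable fseries_bounded])
      (rule l1bound_reflect[OF l1bound_twist[OF DC]])+
  have f3i: "integrable torus f3"
    unfolding f3 by (rule square_integrable_imp_integrable[OF fseries_square_integrable[OF l1bound_twist[OF E]]])
  have f12_four: "fourier (\<lambda>y. f1 y * f2 y) = twist (- \<tau>) (bilin (osc \<tau>) V D)"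
    unfolding f2 using fourier_mult_reflect[OF f1i _ l1bound_twist[OF DC]] l1bound_twist[OF C]
    by (auto simp: fun_eq_iff f1_four conv_twist[symmetric])
  have f3_four: "fourier f3 = twist (- \<tau>) (conv V D)"
    unfolding f3 by (simp add: fun_eq_iff fourier_fseries[OF l1bound_twist[OF E]])
  have g_four: "fourier g = twist (- \<tau>) (\<lambda>k. bilin (osc \<tau>) V D k - conv V D k)"
    unfolding g_def by (simp add: fun_eq_iff fourier_diff[OF f12i f3i] f12_four f3_four twist_def right_diff_distrib)
  \<comment> \<open>The outer \<open>inv_deriv\<close> is a pointwise series; absolute summability
    of the coefficients of \<open>g\<close> is needed before its own coefficients can be read
    off.\<close>
  have "hbound r (bilin (osc \<tau>) V D) (1 * bilin_const r * A * A)"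
    by (rule bilin_bound[OF r _ A DA]) simp
  from hbound_minus[OF this hb_conv]
  have "hbound r (fourier g) (1 * bilin_const r * A * A + 1 * bilin_const r * A * A)"
    unfolding g_four hbound_twist .
  from hbound_imp_l1bound[OF r this] obtain G where G: "l1bound (fourier g) G" by blast
  define h where "h = inv_deriv g"
  have h: "h = fseries (inv_symbol (fourier g))" by (simp add: h_def inv_deriv_fseries)
  have hs: "square_integrable h" unfolding h by (rule fseries_square_integrable[OF l1bound_inv_symbol[OF G]])
  have h_four: "fourier h k = inv_symbol (fourier g) k" for k
    unfolding h by (rule fourier_fseries[OF l1bound_inv_symbol[OF G]])
  define a where "a = - \<i> * \<mu> * of_real \<tau> * cnj (V 0)"
  define b where "b = - \<i> * \<mu> * of_real \<tau> / of_real (2 * pi) * of_real ((l2norm v)\<^sup>2)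
     + \<i> * \<mu> * of_real \<tau> * of_real ((cmod (V 0))\<^sup>2)"
  define c where "c = \<mu> / 2"
  have Phi: "Phi_c1 \<mu> \<tau> v = (\<lambda>x. (a * f1 x + b * 1) + c * h x)"
    by (simp add: c_def fun_eq_iff Phi_c1_def h_def g_def f1_def f2_def f3_def a_def b_def V_def)
  have one: "square_integrable (\<lambda>_. 1)" by (rule square_integrable_bounded[where B = 1]) auto
  show "square_integrable (Phi_c1 \<mu> \<tau> v)"
    unfolding Phi by (intro square_integrable_add square_integrable_cmult f1s hs one)
  have "fourier (Phi_c1 \<mu> \<tau> v) k = a * twist (- \<tau>) V k + b * (if k = 0 then 1 else 0) + c * inv_symbol (fourier g) k"
    unfolding Phi
    by (simp add: fourier_add square_integrable_imp_integrable square_integrable_add square_integrable_cmult f1s hs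
        fourier_cmult f1_four h_four fourier_one one del: mult_1_right)
  also have "\<dots> = - \<i> * \<mu> * twist (- \<tau>) (bilin (prim \<tau>) V V) k"
  proof (cases "k = 0")
    case True
    \<comment> \<open>At \<open>k = 0\<close> the term with \<open>a\<close> cancels the second
      summand of \<open>b\<close>, and by Parseval the remaining mass term is the resonant sum
      \<open>of_real \<tau> * conv V V 0\<close>.\<close>
    have "V 0 * cnj (V 0) = of_real ((cmod (V 0))\<^sup>2)" by (rule complex_norm_square[symmetric])
    then have "a * V 0 = - \<i> * \<mu> * of_real \<tau> * of_real ((cmod (V 0))\<^sup>2)"
      by (simp add: a_def mult_ac)
    moreover have "- \<i> * \<mu> * of_real \<tau> / of_real (2 * pi) * of_real ((l2norm v)\<^sup>2) = - \<i> * \<mu> * (of_real \<tau> * conv V V 0)"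
      unfolding l2norm_square[OF r v] V_def by (simp add: field_simps)
    ultimately show ?thesis
      using True by (simp add: twist_def inv_symbol_def bilin_prim_zero b_def c_def)
  next
    case False
    \<comment> \<open>For \<open>k \<noteq> 0\<close> the constant \<open>b\<close> drops out,
      \<open>a\<close> provides the mode \<open>l = 0\<close>, and \<open>c / (\<i> * k)\<close> is
      \<open>- \<i> * \<mu> / (2 * k)\<close>, the prefactor in
      \<open>bilin_prim_nonzero\<close>.\<close>
    show ?thesis
      using False
      by (simp add: g_four bilin_prim_nonzero[OF C False] twist_def inv_symbol_def a_def c_def D_def) (simp add: field_simps)
  qed
  finally show "fourier (Phi_c1 \<mu> \<tau> v) k = - \<i> * \<mu> * twist (- \<tau>) (bilin (prim \<tau>) (fourier v) (fourier v)) k"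
    by (simp add: V_def)
qed

section \<open>From exact solutions to profiles, and the propagators in the interaction
  picture\<close>

lemma exact_solution_restrict:
  assumes u: "exact_solution \<mu> r T v u" and \<tau>: "\<tau> \<le> T"
  shows "exact_solution \<mu> r \<tau> v u"
proof -
  have sub: "{0..\<tau>} \<subseteq> {0..T}" using \<tau> by auto
  show ?thesis
    unfolding exact_solution_def
  proof (intro conjI ballI allI)
    fix t assume t: "t \<in> {0..\<tau>}"
    then have t': "t \<in> {0..T}" using sub by auto
    show "u t \<in> sobolev r" using u t' by (simp add: exact_solution_def)
    have "((\<lambda>s. hnorm r (\<lambda>x. u s x - u t x)) \<longlongrightarrow> 0) (at t within {0..T})"
      using u t' by (simp add: exact_solution_def)
    then show "((\<lambda>s. hnorm r (\<lambda>x. u s x - u t x)) \<longlongrightarrow> 0) (at t within {0..\<tau>})"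
      by (rule tendsto_within_subset[OF _ sub])
    fix k
    have "((\<lambda>s. fourier (u s) k) has_vector_derivative
           - \<i> * ((of_int k)\<^sup>2 * fourier (u t) k + \<mu> * fourier (\<lambda>x. of_real ((cmod (u t x))\<^sup>2)) k)) (at t within {0..T})"
      using u t' unfolding exact_solution_def by blast
    then show "((\<lambda>s. fourier (u s) k) has_vector_derivative
           - \<i> * ((of_int k)\<^sup>2 * fourier (u t) k + \<mu> * fourier (\<lambda>x. of_real ((cmod (u t x))\<^sup>2)) k)) (at t within {0..\<tau>})"
      by (rule has_vector_derivative_within_subset[OF _ sub])
  qed (use u in \<open>simp add: exact_solution_def\<close>)
qed

text \<open>The integrating factor \<open>cis\<close> of \<open>k^2 * t\<close> cancels the linear
  term of the equation. Continuity in time with values in H^r, on a compact interval, provides the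
  bound demanded by \<open>profile\<close>.\<close>

lemma exact_solution_profile:
  assumes r: "r > 1/2" and u: "exact_solution \<mu> r \<tau> v u"
  shows "profile \<mu> r \<tau> (fourier v) (\<lambda>t. twist t (fourier (u t)))"
  unfolding profile_def
proof (intro conjI ballI allI)
  show "twist 0 (fourier (u 0)) = fourier v"
    using u by (simp add: exact_solution_def)
  have sob: "u t \<in> sobolev r" if "t \<in> {0..\<tau>}" for t
    using u that by (simp add: exact_solution_def)
  have "continuous_on {0..\<tau>} (\<lambda>t. hnorm r (u t))"
    unfolding continuous_on_def
  proof
    fix t assume t: "t \<in> {0..\<tau>}"
    have "((\<lambda>s. hnorm r (u s) - hnorm r (u t)) \<longlongrightarrow> 0) (at t within {0..\<tau>})"
    proof (rule Lim_null_comparison)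
      show "((\<lambda>s. hnorm r (\<lambda>x. u s x - u t x)) \<longlongrightarrow> 0) (at t within {0..\<tau>})"
        using u t by (simp add: exact_solution_def)
      have "norm (hnorm r (u s) - hnorm r (u t)) \<le> hnorm r (\<lambda>x. u s x - u t x)" if "s \<in> {0..\<tau>}" for s
        using hnorm_triangle[OF sob[OF that] sob[OF t]] hnorm_triangle[OF sob[OF t] sob[OF that]]
          hnorm_diff_commute[of r "u s" "u t"] by (simp add: abs_le_iff)
      then show "\<forall>\<^sub>F s in at t within {0..\<tau>}. norm (hnorm r (u s) - hnorm r (u t)) \<le> hnorm r (\<lambda>x. u s x - u t x)"
        by (auto simp: eventually_at_filter)
    qed
    then show "((\<lambda>s. hnorm r (u s)) \<longlongrightarrow> hnorm r (u t)) (at t within {0..\<tau>})"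
      by (simp add: LIM_zero_iff)
  qed
  then have "bounded ((\<lambda>t. hnorm r (u t)) ` {0..\<tau>})"
    by (intro compact_imp_bounded compact_continuous_image) auto
  then obtain B where "\<forall>y\<in>(\<lambda>t. hnorm r (u t)) ` {0..\<tau>}. norm y \<le> B"
    unfolding bounded_iff by blast
  then have B: "\<bar>hnorm r (u t)\<bar> \<le> B" if "t \<in> {0..\<tau>}" for t
    using that by auto
  have "hbound r (twist t (fourier (u t))) (B / sqrt (2 * pi))" if t: "t \<in> {0..\<tau>}" for t
    unfolding hbound_twist
    by (rule hbound_mono[OF sobolev_hbound[OF sob[OF t]]]) (use B[OF t] in \<open>simp add: divide_right_mono\<close>)
  then show "\<exists>B. \<forall>t\<in>{0..\<tau>}. hbound r (twist t (fourier (u t))) B" by blast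
  fix t k assume t: "t \<in> {0..\<tau>}"
  let ?N = "conv (fourier (u t)) (fourier (u t)) k"
  have "((\<lambda>s. fourier (u s) k) has_vector_derivative
         - \<i> * ((of_int k)\<^sup>2 * fourier (u t) k + \<mu> * ?N)) (at t within {0..\<tau>})"
    using u t unfolding exact_solution_def fourier_norm_square[OF r sob[OF t], symmetric] by blast
  then have "((\<lambda>s. cis ((of_int k)\<^sup>2 * s) * fourier (u s) k) has_vector_derivative
      cis ((of_int k)\<^sup>2 * t) * (- \<i> * ((of_int k)\<^sup>2 * fourier (u t) k + \<mu> * ?N))
      + (\<i> * of_real ((of_int k)\<^sup>2) * cis ((of_int k)\<^sup>2 * t)) * fourier (u t) k) (at t within {0..\<tau>})"
    by (intro has_vector_derivative_mult has_vector_derivative_cis_mult)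
  moreover have "cis ((of_int k)\<^sup>2 * t) * (- \<i> * ((of_int k)\<^sup>2 * fourier (u t) k + \<mu> * ?N))
      + (\<i> * of_real ((of_int k)\<^sup>2) * cis ((of_int k)\<^sup>2 * t)) * fourier (u t) k
      = - \<i> * \<mu> * bilin (osc t) (twist t (fourier (u t))) (twist t (fourier (u t))) k"
    unfolding bilin_osc_twist by (simp add: twist_def algebra_simps)
  ultimately show "((\<lambda>s. twist s (fourier (u s)) k) has_vector_derivative
      - \<i> * \<mu> * bilin (osc t) (twist t (fourier (u t))) (twist t (fourier (u t))) k) (at t within {0..\<tau>})"
    by (simp add: twist_def)
qed

text \<open>Here the choice operator is eliminated: whichever solution it selects, the coefficients
  form a profile on \<open>{0..\<tau>}\<close>, and the later estimates hold for all
  profiles.\<close>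

lemma fine_propagator_profile:
  assumes r: "r > 1/2" and \<tau>: "0 \<le> \<tau>" and ex: "\<exists>u. exact_solution \<mu> r \<tau> v u"
  shows "\<exists>A. profile \<mu> r \<tau> (fourier v) A \<and> fine_propagator \<mu> r \<tau> v \<in> sobolev r
           \<and> fourier (fine_propagator \<mu> r \<tau> v) = twist (- \<tau>) (A \<tau>)"
proof -
  define u where "u = (SOME u. exact_solution \<mu> r \<tau> v u)"
  have u: "exact_solution \<mu> r \<tau> v u" unfolding u_def using ex by (rule someI_ex)
  moreover have "u \<tau> \<in> sobolev r" using u \<tau> by (simp add: exact_solution_def)
  ultimately show ?thesis
    using exact_solution_profile[OF r u]
    by (intro exI[of _ "\<lambda>t. twist t (fourier (u t))"]) (simp add: fine_propagator_def u_def twist_twist)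
qed

lemma coarse_propagator_fourier:
  assumes r: "r > 1/2" and v: "v \<in> sobolev r"
  shows "square_integrable (coarse_propagator \<mu> \<tau> v)"
    and "fourier (coarse_propagator \<mu> \<tau> v)
      = twist (- \<tau>) (\<lambda>k. fourier v k - \<i> * \<mu> * bilin (prim \<tau>) (fourier v) (fourier v) k)"
proof -
  obtain C where C: "l1bound (fourier v) C" using sobolev_l1bound[OF r v] by blast
  have s: "square_integrable (schroedinger_group \<tau> v)"
    unfolding schroedinger_group_fseries by (rule fseries_square_integrable[OF l1bound_twist[OF C]])
  have eq: "coarse_propagator \<mu> \<tau> v = (\<lambda>x. schroedinger_group \<tau> v x + Phi_c1 \<mu> \<tau> v x)"
    by (simp add: fun_eq_iff coarse_propagator_def)
  show "square_integrable (coarse_propagator \<mu> \<tau> v)"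
    unfolding eq by (rule square_integrable_add[OF s Phi_c1_fourier(1)[OF r v]])
  show "fourier (coarse_propagator \<mu> \<tau> v)
      = twist (- \<tau>) (\<lambda>k. fourier v k - \<i> * \<mu> * bilin (prim \<tau>) (fourier v) (fourier v) k)"
  proof
    fix k
    have "fourier (coarse_propagator \<mu> \<tau> v) k = fourier (schroedinger_group \<tau> v) k + fourier (Phi_c1 \<mu> \<tau> v) k"
      unfolding eq by (intro fourier_add square_integrable_imp_integrable s Phi_c1_fourier(1)[OF r v])
    also have "fourier (schroedinger_group \<tau> v) k = twist (- \<tau>) (fourier v) k"
      unfolding schroedinger_group_fseries by (rule fourier_fseries[OF l1bound_twist[OF C]])
    finally show "fourier (coarse_propagator \<mu> \<tau> v) k
        = twist (- \<tau>) (\<lambda>k. fourier v k - \<i> * \<mu> * bilin (prim \<tau>) (fourier v) (fourier v) k) k"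
      by (simp add: Phi_c1_fourier(2)[OF r v] twist_def algebra_simps)
  qed
qed

lemma propagator_error_fourier:
  assumes r: "r > 1/2" and v: "v \<in> sobolev r" and F: "f \<in> sobolev r" "fourier f = twist (- \<tau>) (A \<tau>)"
  shows "fourier (\<lambda>x. f x - coarse_propagator \<mu> \<tau> v x) = twist (- \<tau>) (local_error \<mu> (fourier v) A \<tau>)"
proof
  fix k
  have "fourier (\<lambda>x. f x - coarse_propagator \<mu> \<tau> v x) k = fourier f k - fourier (coarse_propagator \<mu> \<tau> v) k"
    by (intro fourier_diff sobolev_integrable[OF F(1)] square_integrable_imp_integrable coarse_propagator_fourier(1)[OF r v])
  then show "fourier (\<lambda>x. f x - coarse_propagator \<mu> \<tau> v x) k = twist (- \<tau>) (local_error \<mu> (fourier v) A \<tau>) k"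
    by (simp add: F(2) coarse_propagator_fourier(2)[OF r v] local_error_def twist_def algebra_simps)
qed

lemma sobolev_ball_hbound:
  assumes "v \<in> sobolev_ball r R"
  shows "v \<in> sobolev r" "hbound r (fourier v) (R / sqrt (2 * pi))"
  using assms hbound_mono[OF sobolev_hbound[of v r], of "R / sqrt (2 * pi)"]
  by (auto simp: sobolev_ball_def divide_right_mono)

text \<open>Transfers the solvability hypothesis from functions to sequences: the compactness
  argument ranges over all sequences in the ball, so each must come from a function in
  \<open>sobolev_ball r R\<close>.\<close>

lemma fseries_sobolev_ball:
  assumes r: "r > 1/2" and a: "hbound r a (R / sqrt (2 * pi))"
  shows "fseries a \<in> sobolev_ball r R" "fourier (fseries a) = a"
proof -
  obtain C where C: "l1bound a C" using hbound_imp_l1bound[OF r a] by blast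
  show four: "fourier (fseries a) = a" by (simp add: fun_eq_iff fourier_fseries[OF C])
  have "hbound r (fourier (fseries a)) (R / sqrt (2 * pi))" using a four by simp
  from hbound_sobolev[OF fseries_square_integrable[OF C] this]
  show "fseries a \<in> sobolev_ball r R" by (simp add: sobolev_ball_def)
qed

section \<open>The two Lipschitz estimates for functions\<close>

lemma Phi_c1_lipschitz:
  assumes r: "r > 1/2" and w: "w \<in> sobolev_ball r R" and v: "v \<in> sobolev_ball r R" and \<tau>: "0 \<le> \<tau>"
  shows "(\<lambda>x. Phi_c1 \<mu> \<tau> w x - Phi_c1 \<mu> \<tau> v x) \<in> sobolev r"
    and "hnorm r (\<lambda>x. Phi_c1 \<mu> \<tau> w x - Phi_c1 \<mu> \<tau> v x)
      \<le> 2 * nonlin_const \<mu> r * (R / sqrt (2 * pi)) * \<tau> * hnorm r (\<lambda>x. w x - v x)"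
proof -
  define A where "A = R / sqrt (2 * pi)"
  define d where "d = hnorm r (\<lambda>x. w x - v x) / sqrt (2 * pi)"
  note ws = sobolev_ball_hbound[OF w, folded A_def] and vs = sobolev_ball_hbound[OF v, folded A_def]
  have d: "hbound r (\<lambda>k. fourier w k - fourier v k) d"
    unfolding d_def by (rule sobolev_diff_hbound(2)[OF ws(1) vs(1)])
  have "hbound r (\<lambda>k. bilin (prim \<tau>) (\<lambda>k. fourier w k - fourier v k) (fourier w) k
      + bilin (prim \<tau>) (fourier v) (\<lambda>k. fourier w k - fourier v k) k)
      (\<tau> * bilin_const r * d * A + \<tau> * bilin_const r * A * d)"
    by (intro hbound_add bilin_bound r norm_prim \<tau> d ws vs)
  also have "(\<lambda>k. bilin (prim \<tau>) (\<lambda>k. fourier w k - fourier v k) (fourier w) k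
      + bilin (prim \<tau>) (fourier v) (\<lambda>k. fourier w k - fourier v k) k)
      = (\<lambda>k. bilin (prim \<tau>) (fourier w) (fourier w) k - bilin (prim \<tau>) (fourier v) (fourier v) k)"
    by (rule ext) (rule bilin_diff_hbound[OF r norm_prim[OF \<tau>] ws(2) vs(2) ws(2) vs(2), symmetric])
  finally have "hbound r (twist (- \<tau>) (\<lambda>k. - \<i> * \<mu> * (bilin (prim \<tau>) (fourier w) (fourier w) k - bilin (prim \<tau>) (fourier v) (fourier v) k)))
      (cmod (- \<i> * \<mu>) * (\<tau> * bilin_const r * d * A + \<tau> * bilin_const r * A * d))"
    unfolding hbound_twist by (rule hbound_cmult)
  moreover have "fourier (\<lambda>x. Phi_c1 \<mu> \<tau> w x - Phi_c1 \<mu> \<tau> v x)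
      = twist (- \<tau>) (\<lambda>k. - \<i> * \<mu> * (bilin (prim \<tau>) (fourier w) (fourier w) k - bilin (prim \<tau>) (fourier v) (fourier v) k))"
    by (simp add: fun_eq_iff Phi_c1_fourier(2)[OF r ws(1)] Phi_c1_fourier(2)[OF r vs(1)] twist_def algebra_simps
        fourier_diff[OF Phi_c1_fourier(1)[OF r ws(1), THEN square_integrable_imp_integrable]
          Phi_c1_fourier(1)[OF r vs(1), THEN square_integrable_imp_integrable]])
  ultimately have hb: "hbound r (fourier (\<lambda>x. Phi_c1 \<mu> \<tau> w x - Phi_c1 \<mu> \<tau> v x))
      (cmod (- \<i> * \<mu>) * (\<tau> * bilin_const r * d * A + \<tau> * bilin_const r * A * d))" by simp
  note sob = hbound_sobolev[OF square_integrable_diff[OF Phi_c1_fourier(1)[OF r ws(1)] Phi_c1_fourier(1)[OF r vs(1)]] hb]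
  show "(\<lambda>x. Phi_c1 \<mu> \<tau> w x - Phi_c1 \<mu> \<tau> v x) \<in> sobolev r" by (rule sob(1))
  have "sqrt (2 * pi) * (cmod (- \<i> * \<mu>) * (\<tau> * bilin_const r * d * A + \<tau> * bilin_const r * A * d))
      = 2 * nonlin_const \<mu> r * A * \<tau> * (sqrt (2 * pi) * d)"
    by (simp add: nonlin_const_def norm_mult algebra_simps)
  also have "sqrt (2 * pi) * d = hnorm r (\<lambda>x. w x - v x)" by (simp add: d_def)
  finally show "hnorm r (\<lambda>x. Phi_c1 \<mu> \<tau> w x - Phi_c1 \<mu> \<tau> v x)
      \<le> 2 * nonlin_const \<mu> r * (R / sqrt (2 * pi)) * \<tau> * hnorm r (\<lambda>x. w x - v x)"
    using sob(2) by (simp only: A_def[symmetric])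
qed

lemma local_error_lipschitz:
  assumes r: "r > 1/2" and T: "T > 0" and ex: "\<forall>v\<in>sobolev_ball r R. \<exists>u. exact_solution \<mu> r T v u"
  shows "\<exists>C\<ge>0. \<forall>w0\<in>sobolev_ball r R. \<forall>v0\<in>sobolev_ball r R. \<forall>\<tau>. 0 < \<tau> \<and> \<tau> \<le> 1 \<and> \<tau> \<le> T \<longrightarrow>
       (\<lambda>x. (fine_propagator \<mu> r \<tau> w0 x - coarse_propagator \<mu> \<tau> w0 x)
            - (fine_propagator \<mu> r \<tau> v0 x - coarse_propagator \<mu> \<tau> v0 x)) \<in> sobolev r \<and>
       hnorm r (\<lambda>x. (fine_propagator \<mu> r \<tau> w0 x - coarse_propagator \<mu> \<tau> w0 x)
                    - (fine_propagator \<mu> r \<tau> v0 x - coarse_propagator \<mu> \<tau> v0 x))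
         \<le> C * \<tau>\<^sup>2 * hnorm r (\<lambda>x. w0 x - v0 x)"
proof -
  have "\<exists>A. profile \<mu> r T a A" if a: "hbound r a (R / sqrt (2 * pi))" for a
  proof -
    obtain u where "exact_solution \<mu> r T (fseries a) u"
      using ex fseries_sobolev_ball(1)[OF r a] by blast
    from exact_solution_profile[OF r this] show ?thesis
      unfolding fseries_sobolev_ball(2)[OF r a] by blast
  qed
  then obtain M where M: "\<And>a A \<tau> t. hbound r a (R / sqrt (2 * pi)) \<Longrightarrow> \<tau> \<le> T \<Longrightarrow> profile \<mu> r \<tau> a A \<Longrightarrow>
      t \<in> {0..\<tau>} \<Longrightarrow> hbound r (A t) M"
    using profile_uniform_bound[OF r, of T "R / sqrt (2 * pi)" \<mu>] T by (meson less_imp_le)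
  define q where "q = nonlin_const \<mu> r"
  define C where "C = q\<^sup>2 * M\<^sup>2 * (10 * exp (4 * q * M) + 1)"
  have "(\<lambda>x. (fine_propagator \<mu> r \<tau> w x - coarse_propagator \<mu> \<tau> w x)
            - (fine_propagator \<mu> r \<tau> v x - coarse_propagator \<mu> \<tau> v x)) \<in> sobolev r \<and>
       hnorm r (\<lambda>x. (fine_propagator \<mu> r \<tau> w x - coarse_propagator \<mu> \<tau> w x)
                    - (fine_propagator \<mu> r \<tau> v x - coarse_propagator \<mu> \<tau> v x))
         \<le> C * \<tau>\<^sup>2 * hnorm r (\<lambda>x. w x - v x)"
    if w: "w \<in> sobolev_ball r R" and v: "v \<in> sobolev_ball r R" and \<tau>: "0 < \<tau>" "\<tau> \<le> 1" "\<tau> \<le> T" for w v \<tau>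
  proof -
    note ws = sobolev_ball_hbound[OF w] and vs = sobolev_ball_hbound[OF v]
    have \<tau>0: "0 \<le> \<tau>" using \<tau> by simp
    have "\<exists>u. exact_solution \<mu> r \<tau> w u" "\<exists>u. exact_solution \<mu> r \<tau> v u"
      using ex w v exact_solution_restrict[OF _ \<tau>(3)] by blast+
    then obtain W V where W: "profile \<mu> r \<tau> (fourier w) W" "fine_propagator \<mu> r \<tau> w \<in> sobolev r"
        "fourier (fine_propagator \<mu> r \<tau> w) = twist (- \<tau>) (W \<tau>)"
      and V: "profile \<mu> r \<tau> (fourier v) V" "fine_propagator \<mu> r \<tau> v \<in> sobolev r"
        "fourier (fine_propagator \<mu> r \<tau> v) = twist (- \<tau>) (V \<tau>)"
      using fine_propagator_profile[OF r \<tau>0] by meson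
    define d where "d = hnorm r (\<lambda>x. w x - v x) / sqrt (2 * pi)"
    have d: "hbound r (\<lambda>k. fourier w k - fourier v k) d"
      unfolding d_def by (rule sobolev_diff_hbound(2)[OF ws(1) vs(1)])
    have err: "hbound r (\<lambda>k. local_error \<mu> (fourier w) W \<tau> k - local_error \<mu> (fourier v) V \<tau> k) (C * \<tau>\<^sup>2 * d)"
      unfolding C_def q_def
      by (rule local_error_bound[OF r W(1) V(1) M[OF ws(2) \<tau>(3) W(1)] M[OF vs(2) \<tau>(3) V(1)] d \<tau>0 \<tau>(2)])
    define e where "e = (\<lambda>v x. fine_propagator \<mu> r \<tau> v x - coarse_propagator \<mu> \<tau> v x)"
    have sq: "square_integrable (e w)" "square_integrable (e v)"
      unfolding e_def
      by (intro square_integrable_diff sobolev_square_integrable[of _ r] coarse_propagator_fourier(1)[OF r] W(2) V(2) ws(1) vs(1))+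
    have e_four: "fourier (e w) = twist (- \<tau>) (local_error \<mu> (fourier w) W \<tau>)"
        "fourier (e v) = twist (- \<tau>) (local_error \<mu> (fourier v) V \<tau>)"
      unfolding e_def by (intro propagator_error_fourier[OF r] ws(1) vs(1) W V)+
    have "fourier (\<lambda>x. e w x - e v x)
        = twist (- \<tau>) (\<lambda>k. local_error \<mu> (fourier w) W \<tau> k - local_error \<mu> (fourier v) V \<tau> k)"
      by (simp add: fun_eq_iff fourier_diff[OF sq[THEN square_integrable_imp_integrable]] e_four twist_def right_diff_distrib)
    then have "hbound r (fourier (\<lambda>x. e w x - e v x)) (C * \<tau>\<^sup>2 * d)"
      using err by (simp add: hbound_twist)
    note sob = hbound_sobolev[OF square_integrable_diff[OF sq] this]
    have "sqrt (2 * pi) * (C * \<tau>\<^sup>2 * d) = C * \<tau>\<^sup>2 * hnorm r (\<lambda>x. w x - v x)"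
      by (simp add: d_def)
    with sob show ?thesis by (simp add: e_def)
  qed
  moreover have "C \<ge> 0" by (simp add: C_def)
  ultimately show ?thesis by blast
qed

theorem lemma4p1:
  fixes r R T :: real and \<mu> :: complex
  assumes "r > 1/2" and "R > 0" and "T > 0"
  shows "\<exists>C::real.
    (\<forall>w0 \<in> sobolev_ball r R. \<forall>v0 \<in> sobolev_ball r R. \<forall>\<tau>. 0 < \<tau> \<and> \<tau> \<le> 1 \<longrightarrow>
       (\<lambda>x. Phi_c1 \<mu> \<tau> w0 x - Phi_c1 \<mu> \<tau> v0 x) \<in> sobolev r \<and>
       hnorm r (\<lambda>x. Phi_c1 \<mu> \<tau> w0 x - Phi_c1 \<mu> \<tau> v0 x)
         \<le> C * \<tau> * hnorm r (\<lambda>x. w0 x - v0 x)) \<and>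
    ((\<forall>v \<in> sobolev_ball r R. \<exists>u. exact_solution \<mu> r T v u) \<longrightarrow>
     (\<forall>w0 \<in> sobolev_ball r R. \<forall>v0 \<in> sobolev_ball r R. \<forall>\<tau>. 0 < \<tau> \<and> \<tau> \<le> 1 \<and> \<tau> \<le> T \<longrightarrow>
       (\<lambda>x. (fine_propagator \<mu> r \<tau> w0 x - coarse_propagator \<mu> \<tau> w0 x)
            - (fine_propagator \<mu> r \<tau> v0 x - coarse_propagator \<mu> \<tau> v0 x)) \<in> sobolev r \<and>
       hnorm r (\<lambda>x. (fine_propagator \<mu> r \<tau> w0 x - coarse_propagator \<mu> \<tau> w0 x)
                    - (fine_propagator \<mu> r \<tau> v0 x - coarse_propagator \<mu> \<tau> v0 x))
         \<le> C * \<tau>\<^sup>2 * hnorm r (\<lambda>x. w0 x - v0 x)))"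
proof -
  define C1 where "C1 = 2 * nonlin_const \<mu> r * (R / sqrt (2 * pi))"
  define P where "P = (\<lambda>C2. \<forall>w0\<in>sobolev_ball r R. \<forall>v0\<in>sobolev_ball r R. \<forall>\<tau>. 0 < \<tau> \<and> \<tau> \<le> 1 \<and> \<tau> \<le> T \<longrightarrow>
       (\<lambda>x. (fine_propagator \<mu> r \<tau> w0 x - coarse_propagator \<mu> \<tau> w0 x)
            - (fine_propagator \<mu> r \<tau> v0 x - coarse_propagator \<mu> \<tau> v0 x)) \<in> sobolev r \<and>
       hnorm r (\<lambda>x. (fine_propagator \<mu> r \<tau> w0 x - coarse_propagator \<mu> \<tau> w0 x)
                    - (fine_propagator \<mu> r \<tau> v0 x - coarse_propagator \<mu> \<tau> v0 x))
         \<le> C2 * \<tau>\<^sup>2 * hnorm r (\<lambda>x. w0 x - v0 x))"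
  have "C1 \<ge> 0" using assms by (simp add: C1_def nonlin_const_nonneg)
  have P_mono: "P D" if "P C" "C \<le> D" for C D
  proof -
    have "C * \<tau>\<^sup>2 * hnorm r f \<le> D * \<tau>\<^sup>2 * hnorm r f" for \<tau> f
      using that by (intro mult_right_mono) auto
    then show ?thesis using that(1) unfolding P_def by (meson order_trans)
  qed
  \<comment> \<open>The constant is quantified in front of the implication, so it must be named even
    if the existence hypothesis fails; then 0 is taken. As both constants are nonnegative,
    \<open>C1 + C2\<close> serves both claims.\<close>
  obtain C2 where "C2 \<ge> 0" and C2: "(\<forall>v\<in>sobolev_ball r R. \<exists>u. exact_solution \<mu> r T v u) \<longrightarrow> P C2"
  proof (cases "\<forall>v\<in>sobolev_ball r R. \<exists>u. exact_solution \<mu> r T v u")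
    case True
    from local_error_lipschitz[OF assms(1,3) this] show ?thesis
      using that unfolding P_def by blast
  next
    case False
    then show ?thesis by (intro that[of 0]) (simp, blast)
  qed
  have one: "(\<lambda>x. Phi_c1 \<mu> \<tau> w x - Phi_c1 \<mu> \<tau> v x) \<in> sobolev r \<and>
      hnorm r (\<lambda>x. Phi_c1 \<mu> \<tau> w x - Phi_c1 \<mu> \<tau> v x) \<le> (C1 + C2) * \<tau> * hnorm r (\<lambda>x. w x - v x)"
    if "w \<in> sobolev_ball r R" "v \<in> sobolev_ball r R" "0 < \<tau>" for w v \<tau>
  proof -
    have "C1 * \<tau> * hnorm r (\<lambda>x. w x - v x) \<le> (C1 + C2) * \<tau> * hnorm r (\<lambda>x. w x - v x)"
      using \<open>C2 \<ge> 0\<close> that by (intro mult_right_mono) auto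
    then show ?thesis
      using Phi_c1_lipschitz[OF assms(1) that(1,2), of \<tau> \<mu>] that(3) unfolding C1_def by linarith
  qed
  have "(\<forall>v\<in>sobolev_ball r R. \<exists>u. exact_solution \<mu> r T v u) \<longrightarrow> P (C1 + C2)"
    using C2 P_mono[of C2 "C1 + C2"] \<open>C1 \<ge> 0\<close> by simp
  with one show ?thesis
    unfolding P_def by (intro exI[of _ "C1 + C2"]) simp
qed

end
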